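(* Let $M=(M_p)_{p\in\mathbb{N}}\in\mathcal{LC}$ and $c>0$. Assume that there exist a strictly increasing sequence of nonnegative integers $(a_j)_{j\ge1}$ and constants $K\ge b>2$ such that for all $j\ge 1$ $$b\le\min\{A_M(a_j,a_{j+1}),B_M(a_j,a_{j+1})\}\le\max\{A_M(a_j,a_{j+1}),B_M(a_j,a_{j+1})\}\le K.$$ Then the solid hull of $H^{\infty}_{v_{M,c}}(\mathbb{C})$ is $$S(H^{\infty}_{v_{M,c}}(\mathbb{C}))=\left\{(b_j)_{j\in\mathbb{N}}\in\mathbb{C}^{\mathbb{N}}:\ \sup_{j\ge1}v_{M,c}(r_{a_j,c})\left(\sum_{a_j<l\le a_{j+1}}|b_l|^2(r_{a_j,c})^{2l}\right)^{1/2}<+\infty\right\},$$ where $r_{a_j,c}=\mu_{a_j+1}/c$, or equivalently $$S(H^{\infty}_{v_{M,c}}(\mathbb{C}))=\left\{(b_j)_{j\in\mathbb{N}}\in\mathbb{C}^{\mathbb{N}}:\ \sup_{j\ge1}\frac{M_{a_j+1}}{(\mu_{a_j+1})^{a_j+1}}\left(\sum_{a_j<l\le a_{j+1}}|b_l|^2\left(\frac{\mu_{a_j+1}}{c}\right)^{2l}\right)^{1/2}<+\infty\right\}.$$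
   Context: $\mathbb{N}=\{0,1,2,\dots\}$. For a sequence $M=(M_p)_{p\in\mathbb{N}}$ of positive reals put $\mu_p:=M_p/M_{p-1}$ for $p\ge1$ and $\mu_0:=1$. $\mathcal{LC}$ is the set of all such $M$ with $M_0=1\le M_1$, $M_p^2\le M_{p-1}M_{p+1}$ for all $p\ge1$, and $\lim_{p\to\infty}(M_p)^{1/p}=+\infty$. The associated weight function is $\omega_M(t):=\sup_{p\in\mathbb{N}}\log(t^p/M_p)$ for $t>0$, $\omega_M(0):=0$. For $c>0$ set $v_{M,c}(r):=\exp(-\omega_M(cr))$, $r\ge0$, and $H^{\infty}_{v_{M,c}}(\mathbb{C}):=\{f \text{ entire}:\ \sup_{z\in\mathbb{C}}|f(z)|v_{M,c}(|z|)<+\infty\}$; an entire function $f(z)=\sum_{j\ge0}a_jz^j$ is identified with its sequence of Taylor coefficients $(a_j)_{j\in\mathbb{N}}$. For integers $0\le k<l$, $$A_M(k,l):=\frac{(\mu_{l+1})^{l-k}}{\mu_{k+1}\cdots\mu_l},\qquad B_M(k,l):=\frac{\mu_{k+1}\cdots\mu_l}{(\mu_{k+1})^{l-k}}.$$ A vector space $A$ of complex sequences is solid if $(a_j)_j\in A$ and $|b_j|\le|a_j|$ for all $j$ imply $(b_j)_j\in A$. The solid hull $S(A)$ is the smallest solid superspace: $S(A)=\{(b_j)_j:\exists (a_j)_j\in A,\ |b_j|\le|a_j|\ \forall j\}$. *)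

theory Defs
  imports "HOL-Complex_Analysis.Complex_Analysis"
begin

definition mu :: "(nat \<Rightarrow> real) \<Rightarrow> nat \<Rightarrow> real" where
  "mu M p = (if p = 0 then 1 else M p / M (p - 1))"

definition LC :: "(nat \<Rightarrow> real) set" where
  "LC = {M. (\<forall>p. M p > 0) \<and> M 0 = 1 \<and> 1 \<le> M 1 \<and>
            (\<forall>p\<ge>1. (M p)\<^sup>2 \<le> M (p - 1) * M (p + 1)) \<and>
            filterlim (\<lambda>p. root p (M p)) at_top sequentially}"

text \<open>For \<open>M \<in> LC\<close> and \<open>t > 0\<close> the supremum is over a bounded set, because
  \<open>root p (M p)\<close> tends to infinity; so the real-valued \<open>SUP\<close> is the actual supremum.\<close>

definition omega :: "(nat \<Rightarrow> real) \<Rightarrow> real \<Rightarrow> real" where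
  "omega M t = (if t > 0 then (SUP p. ln (t ^ p / M p)) else 0)"

definition weight :: "(nat \<Rightarrow> real) \<Rightarrow> real \<Rightarrow> real \<Rightarrow> real" where
  "weight M c r = exp (- omega M (c * r))"

definition H_inf :: "(real \<Rightarrow> real) \<Rightarrow> (complex \<Rightarrow> complex) set" where
  "H_inf v = {f. f holomorphic_on UNIV \<and> bdd_above (range (\<lambda>z. norm (f z) * v (norm z)))}"

definition taylor_coeffs :: "(complex \<Rightarrow> complex) \<Rightarrow> nat \<Rightarrow> complex" where
  "taylor_coeffs f j = fps_nth (fps_expansion f 0) j"

definition H_inf_seq :: "(real \<Rightarrow> real) \<Rightarrow> (nat \<Rightarrow> complex) set" where
  "H_inf_seq v = taylor_coeffs ` H_inf v"

definition A_quot :: "(nat \<Rightarrow> real) \<Rightarrow> nat \<Rightarrow> nat \<Rightarrow> real" where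
  "A_quot M k l = mu M (l + 1) ^ (l - k) / (\<Prod>i=k+1..l. mu M i)"

definition B_quot :: "(nat \<Rightarrow> real) \<Rightarrow> nat \<Rightarrow> nat \<Rightarrow> real" where
  "B_quot M k l = (\<Prod>i=k+1..l. mu M i) / mu M (k + 1) ^ (l - k)"

definition solid :: "(nat \<Rightarrow> complex) set \<Rightarrow> bool" where
  "solid A \<longleftrightarrow> (\<forall>a\<in>A. \<forall>b. (\<forall>j. norm (b j) \<le> norm (a j)) \<longrightarrow> b \<in> A)"

definition solid_hull :: "(nat \<Rightarrow> complex) set \<Rightarrow> (nat \<Rightarrow> complex) set" where
  "solid_hull A = {b. \<exists>a\<in>A. \<forall>j. norm (b j) \<le> norm (a j)}"

text \<open>\<open>solid\<close> does not ask for a subspace, so the hull is least among all solid supersets,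
  in particular among the solid vector spaces containing \<open>A\<close> whenever it is one itself.\<close>

lemma solid_hull_least:
  shows "A \<subseteq> solid_hull A"
    and "solid (solid_hull A)"
    and "A \<subseteq> B \<Longrightarrow> solid B \<Longrightarrow> solid_hull A \<subseteq> B"
  by (auto simp: solid_hull_def solid_def intro: order_trans; blast intro: order_trans)+

definition radius :: "(nat \<Rightarrow> real) \<Rightarrow> real \<Rightarrow> nat \<Rightarrow> real" where
  "radius M c n = mu M (n + 1) / c"

end

theory Submission
  imports Defs "HOL-Computational_Algebra.Fundamental_Theorem_Algebra"
begin

text \<open>
  Throughout, \<open>\<tau>\<^sub>j = mu M (a j + 1)\<close> and the critical radii are \<open>r\<^sub>j = \<tau>\<^sub>j / c\<close>. At \<open>r\<^sub>j\<close> the supremum defining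
  the weight is attained at the exponent \<open>a j\<close>, so that \<open>v(r\<^sub>j) = M (a j) / \<tau>\<^sub>j ^ a j\<close>
  (\<open>weight_radius\<close>); this makes the two descriptions of the hull the same set.

  One inclusion is the Bessel inequality: if \<open>|f| v \<le> S\<close>, then on the circle of radius \<open>r\<^sub>j\<close> the
  square sum of the terms \<open>f\<^sub>l r\<^sub>j ^ l\<close> is at most \<open>(S / v(r\<^sub>j))\<^sup>2\<close>, and this bound passes to every
  sequence dominated by the Taylor coefficients (\<open>taylor_coeffs_square_sum_le\<close>).

  For the other inclusion each block of coefficients, normalised at its own radius, is a vector of
  bounded Euclidean norm. One needs a polynomial with frequencies exactly in that block,
  with coefficients at least as large in modulus as the given ones, and with maximum
  modulus bounded by a constant times the Euclidean norm
  (\<open>coefficient_majorant_polynomial\<close>, a sharply localised form of the theorems of de Leeuw,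
  Katznelson and Kahane and of Kisliakov). Localisation has to be sharp because adjacent blocks may
  have lengths of very different orders. Since the blocks do not overlap, the polynomials can simply
  be added: the block \<open>j\<close> contributes at radius \<open>r\<close> at most a multiple of
  \<open>v(r) (c r) ^ a j / M (a j)\<close> or \<open>v(r) (c r) ^ a (j+1) / M (a (j+1))\<close>, according to the side of
  \<open>r\<^sub>j\<close> on which \<open>r\<close> lies, and the lower bounds on the quotients \<open>A\<close> and \<open>B\<close> make these numbers
  decay geometrically away from \<open>r\<close> (\<open>two_sided_geometric_sum\<close>).

  The polynomial is found by a sign choice in the manner of Bang and Nazarov. Let \<open>\<Phi>(g)\<close> be the
  minimum, over all corrections \<open>u\<close> with finitely many strictly lower frequencies, of the mean of
  \<open>sqrt (1 + |g + u|\<^sup>2)\<close>. The gradient of \<open>\<Phi>\<close> at \<open>g\<close> is the function \<open>w / sqrt (1 + |w|\<^sup>2)\<close> with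
  \<open>w\<close> the minimiser; it is bounded by 1, and by minimality it has no Fourier coefficients at the
  lower frequencies, so a Fejer mean turns it into a polynomial that is cut sharply on one
  side (\<open>dual_polynomial_bound\<close>). Choose the signs of the coefficients so as to maximise \<open>\<Phi>\<close>. Flipping
  one sign cannot increase \<open>\<Phi>\<close>, while convexity supplies a second-order gain; hence the gradient has
  a coefficient comparable with the prescribed one. The gain is controlled from below by Jensen's
  inequality: two minimisers whose data differ at one frequency differ by a trigonometric polynomial
  \<open>D\<close> whose top coefficient is that difference, and the mean of \<open>sqrt |D|\<close> is at least the square root
  of the top coefficient in modulus (\<open>sqrt_norm_lead_coeff_le_circle_mean\<close>). Maximising the sum of \<open>\<Phi>\<close>
  and its mirror image makes the polynomial sharply cut on both sides.
\<close>

section \<open>Means over the unit circle\<close>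

definition circle_mean :: "(complex \<Rightarrow> 'a::banach) \<Rightarrow> 'a" where
  "circle_mean f = integral {0..1} (\<lambda>t. f (cis (2 * pi * t)))"

lemma circle_integrable:
  fixes f :: "complex \<Rightarrow> 'a::banach"
  assumes "continuous_on (sphere 0 1) f"
  shows "(\<lambda>t. f (cis (2 * pi * t))) integrable_on {0..1}"
proof (rule integrable_continuous_real)
  show "continuous_on {0..1} (\<lambda>t. f (cis (2 * pi * t)))"
    by (rule continuous_on_compose2[OF assms]) (auto intro!: continuous_intros)
qed

lemma circle_mean_const [simp]: "circle_mean (\<lambda>z. c) = c"
  by (simp add: circle_mean_def)

lemma circle_mean_cong:
  assumes "\<And>z. norm z = 1 \<Longrightarrow> f z = g z"
  shows "circle_mean f = circle_mean g"
  unfolding circle_mean_def using assms by (intro integral_cong) auto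

lemma circle_mean_add:
  assumes "continuous_on (sphere 0 1) f" "continuous_on (sphere 0 1) g"
  shows "circle_mean (\<lambda>z. f z + g z) = circle_mean f + circle_mean g"
  unfolding circle_mean_def by (intro integral_add circle_integrable assms)

lemma circle_mean_mult_left:
  fixes c :: "'a::{banach,real_normed_field}"
  assumes "continuous_on (sphere 0 1) f"
  shows "circle_mean (\<lambda>z. c * f z) = c * circle_mean f"
  unfolding circle_mean_def
  by (rule integral_unique has_integral_mult_right integrable_integral circle_integrable assms)+

lemma circle_mean_sum:
  assumes "finite I" "\<And>i. i \<in> I \<Longrightarrow> continuous_on (sphere 0 1) (f i)"
  shows "circle_mean (\<lambda>z. \<Sum>i\<in>I. f i z) = (\<Sum>i\<in>I. circle_mean (f i))"
  unfolding circle_mean_def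
  by (intro integral_sum circle_integrable assms)

lemma circle_mean_Re:
  assumes "continuous_on (sphere 0 1) f"
  shows "circle_mean (\<lambda>z. Re (f z)) = Re (circle_mean f)"
  unfolding circle_mean_def
  using integral_linear[OF circle_integrable[OF assms] bounded_linear_Re] by (simp add: o_def)

lemma circle_mean_of_real:
  assumes "continuous_on (sphere 0 1) f"
  shows "circle_mean (\<lambda>z. complex_of_real (f z)) = of_real (circle_mean f)"
  unfolding circle_mean_def
  using integral_linear[OF circle_integrable[OF assms] bounded_linear_of_real] by (simp add: o_def)

lemma circle_mean_mono:
  fixes f g :: "complex \<Rightarrow> real"
  assumes "continuous_on (sphere 0 1) f" "continuous_on (sphere 0 1) g"
    and "\<And>z. norm z = 1 \<Longrightarrow> f z \<le> g z"
  shows "circle_mean f \<le> circle_mean g"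
  unfolding circle_mean_def using assms(3) by (intro integral_le circle_integrable assms) auto

lemma norm_circle_mean_le:
  fixes f :: "complex \<Rightarrow> 'a::banach"
  assumes "continuous_on (sphere 0 1) f" "continuous_on (sphere 0 1) g"
    and "\<And>z. norm z = 1 \<Longrightarrow> norm (f z) \<le> g z"
  shows "norm (circle_mean f) \<le> circle_mean g"
  unfolding circle_mean_def using assms(3) 
  by (intro integral_norm_bound_integral circle_integrable assms) auto

lemma circle_mean_monomials:
  "circle_mean (\<lambda>z. z ^ m * cnj z ^ n) = (if m = n then 1 else 0)"
proof (cases "m = n")
  case True
  have "circle_mean (\<lambda>z. z ^ m * cnj z ^ n) = circle_mean (\<lambda>z. 1::complex)"
    by (rule circle_mean_cong) 
       (simp add: True complex_mult_cnj cmod_power2[symmetric] flip: power_mult_distrib)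
  then show ?thesis using True by simp
next
  case False
  define k where "k = 2 * pi * (real m - real n)"
  have "k \<noteq> 0" using False by (simp add: k_def)
  have eq: "cis (2 * pi * t) ^ m * cnj (cis (2 * pi * t)) ^ n = cis (k * t)" for t
    by (simp add: Complex.DeMoivre cis_cnj cis_mult k_def algebra_simps)
  have "((\<lambda>t. exp (\<i> * k * of_real t) / (\<i> * k)) has_vector_derivative exp (\<i> * k * of_real t)) (at t within {0..1})" for t
    using \<open>k \<noteq> 0\<close> 
    by (intro has_vector_derivative_real_field) (auto intro!: derivative_eq_intros)
  then have "((\<lambda>t. cis (k * t) / (\<i> * k)) has_vector_derivative cis (k * t)) (at t within {0..1})" for t
    by (simp add: cis_conv_exp mult.assoc)
  then have "((\<lambda>t. cis (k * t)) has_integral (cis (k * 1) / (\<i> * k) - cis (k * 0) / (\<i> * k))) {0..1}"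
    by (intro fundamental_theorem_of_calculus) auto
  moreover have "cis k = 1"
    using cis_multiple_2pi[of "real m - real n"] by (simp add: k_def mult.commute)
  ultimately have "((\<lambda>t. cis (k * t)) has_integral 0) {0..1}" by simp
  then show ?thesis
    using False by (simp add: circle_mean_def eq integral_unique)
qed

text \<open>
  Cauchy's integral formula for derivatives, read as a formula for Fourier coefficients.
\<close>

lemma circle_mean_Cauchy:
  assumes "continuous_on (cball 0 r) f" "f holomorphic_on ball 0 r" "r > 0"
  shows "circle_mean (\<lambda>z. f (r * z) * cnj z ^ n) = (deriv ^^ n) f 0 / fact n * r ^ n"
proof -
  have "((\<lambda>u. f u / (u - 0) ^ Suc n) has_contour_integral 
          (2 * pi * \<i>) / (fact n) * (deriv ^^ n) f 0) (circlepath 0 r)"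
    using assms by (intro Cauchy_has_contour_integral_higher_derivative_circlepath) auto
  then have "((\<lambda>t. f (r * cis (2*pi*t)) / (r * cis (2*pi*t)) ^ Suc n * (2 * pi * \<i> * r * cis (2*pi*t))) 
      has_integral (2 * pi * \<i>) / (fact n) * (deriv ^^ n) f 0) {0..1}"
    unfolding has_contour_integral circlepath_def vector_derivative_part_circlepath
    by (rule has_integral_eq[rotated]) 
      (simp add: part_circlepath_def linepath_def cis_conv_exp scaleR_conv_of_real mult_ac)
  then have "((\<lambda>t. r ^ n / (2 * pi * \<i>) * (f (r * cis (2*pi*t)) / (r * cis (2*pi*t)) ^ Suc n * (2 * pi * \<i> * r * cis (2*pi*t)))) 
      has_integral r ^ n / (2 * pi * \<i>) *((2 * pi * \<i>) / (fact n) * (deriv ^^ n) f 0)) {0..1}"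
    by (rule has_integral_mult_right)
  moreover have "r ^ n / (2 * pi * \<i>) * (f (r * z) / (r * z) ^ Suc n * (2 * pi * \<i> * r * z))
      = f (r * z) * cnj z ^ n" if "norm z = 1" for z :: complex
  proof -
    have "z \<noteq> 0" using that by auto
    have "cnj z = inverse z" using that by (metis complex_div_cnj div_by_1 divide_inverse inverse_eq_divide mult_1 of_real_1 one_power2)
    then have "z ^ n * cnj z ^ n = 1" using \<open>z \<noteq> 0\<close> by (simp flip: power_mult_distrib)
    with \<open>z \<noteq> 0\<close> \<open>r > 0\<close> show ?thesis by (simp add: field_simps)
  qed
  ultimately have int: "((\<lambda>t. f (r * cis (2*pi*t)) * cnj (cis (2*pi*t)) ^ n) 
      has_integral r ^ n / (2 * pi * \<i>) *((2 * pi * \<i>) / (fact n) * (deriv ^^ n) f 0)) {0..1}"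
    by simp
  have "R / C * (C / F * D) = D / F * R" if "C \<noteq> 0" for C D F R :: complex
    using that by simp
  then have "of_real r ^ n / (2 * pi * \<i>) * ((2 * pi * \<i>) / (fact n) * (deriv ^^ n) f 0) 
      = (deriv ^^ n) f 0 / fact n * of_real r ^ n" 
    by (metis complex_i_not_zero mult_eq_0_iff of_real_eq_0_iff pi_neq_zero zero_neq_numeral)
  then show ?thesis
    unfolding circle_mean_def using integral_unique[OF int, unfolded of_real_power] by (rule trans[rotated])
qed

section \<open>Jensen's inequality for the top coefficient\<close>

lemma continuous_on_circle_mean:
  fixes f :: "'b::topological_space \<Rightarrow> complex \<Rightarrow> 'a::banach"
  assumes "continuous_on (U \<times> sphere 0 1) (\<lambda>(x, z). f x z)"
  shows "continuous_on U (\<lambda>x. circle_mean (f x))"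
proof -
  have "continuous_on (U \<times> cbox 0 1) (\<lambda>(x, t). f x (cis (2 * pi * t)))"
    using continuous_on_compose2[OF assms, of "U \<times> cbox 0 1" "\<lambda>(x, t). (x, cis (2 * pi * t))"]
    by (force simp: case_prod_beta intro!: continuous_intros)
  from integral_continuous_on_param[OF this] show ?thesis
    by (simp add: circle_mean_def)
qed

text \<open>
  Replace every factor \<open>z - \<alpha>\<close> with a root inside the disc by its reflection
  \<open>1 - cnj \<alpha> * z\<close>. Moduli on the circle do not change, the product loses its zeros in the
  open disc, and its value at the origin is at least the leading coefficient in modulus. The
  zero-free product has a holomorphic square root in the disc, to which the mean value property
  applies.
\<close>

theorem sqrt_norm_lead_coeff_le_circle_mean:
  "sqrt (norm (lead_coeff p)) \<le> circle_mean (\<lambda>z. sqrt (norm (poly p z)))"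
proof (cases "p = 0")
  case False
  obtain \<alpha> where p: "smult (lead_coeff p) (\<Prod>i<degree p. [:-\<alpha> i, 1:]) = p"
    by (rule complex_poly_decompose')
  define q where "q i z = (if norm (\<alpha> i) < 1 then 1 - cnj (\<alpha> i) * z else z - \<alpha> i)" for i z
  define f where "f z = lead_coeff p * (\<Prod>i<degree p. q i z)" for z
  have q_hol: "q i holomorphic_on S" for i S
    unfolding q_def by (cases "norm (\<alpha> i) < 1") (auto intro!: holomorphic_intros)
  have f_hol: "f holomorphic_on S" for S
    unfolding f_def by (intro holomorphic_intros q_hol)
  have norm_q: "norm (q i z) = norm (z - \<alpha> i)" if "norm z = 1" for i z
  proof -
    have "1 - cnj (\<alpha> i) * z = z * cnj (z - \<alpha> i)"
      using that complex_norm_square[of z] by (simp add: algebra_simps)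
    then show ?thesis using that by (simp add: q_def norm_mult flip: complex_cnj_diff)
  qed
  have norm_f: "norm (f z) = norm (poly p z)" if "norm z = 1" for z
    by (subst p[symmetric])
      (use that in \<open>simp add: f_def norm_mult poly_prod prod_norm[symmetric] norm_q\<close>)
  have q_nz: "q i z \<noteq> 0" if "norm z < 1" for i z
  proof (cases "norm (\<alpha> i) < 1")
    case True
    have "norm (cnj (\<alpha> i) * z) \<noteq> norm (1::complex)"
      using that True mult_strict_mono'[of "norm (\<alpha> i)" 1 "norm z" 1] by (simp add: norm_mult)
    then show ?thesis using True by (auto simp: q_def)
  qed (use that in \<open>auto simp: q_def\<close>)
  have f_nz: "f z \<noteq> 0" if "z \<in> ball 0 1" for z
    using q_nz[of z] that False by (simp add: f_def)
  obtain h where h: "h holomorphic_on ball 0 1" "\<And>z. z \<in> ball 0 1 \<Longrightarrow> f z = (h z)\<^sup>2"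
    using contractible_imp_holomorphic_sqrt[OF f_hol, of "ball 0 1"] f_nz
    by (metis convex_imp_contractible convex_ball)
  have norm_h: "norm (h z) = sqrt (norm (f z))" if "z \<in> ball 0 1" for z
    using h(2)[OF that] by (simp add: norm_power)
  \<comment> \<open>A reflected factor is 1 at the origin, an unreflected one is \<open>- \<alpha>\<close> with \<open>norm \<alpha> \<ge> 1\<close>.\<close>
  have "1 \<le> (\<Prod>i<degree p. norm (q i 0))"
    by (rule prod_ge_1) (auto simp: q_def)
  then have "norm (lead_coeff p) \<le> norm (f 0)"
    by (simp add: f_def norm_mult prod_norm[symmetric] mult_le_cancel_left1)
  then have *: "sqrt (norm (lead_coeff p)) \<le> norm (h 0)"
    by (simp add: norm_h)
  \<comment> \<open>Roots may lie on the circle itself, so the mean is first taken on smaller circles.\<close>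
  have interior: "norm (h 0) \<le> circle_mean (\<lambda>z. sqrt (norm (f (\<rho> * z))))" 
    if "\<rho> \<in> {0<..<1}" for \<rho> :: real
  proof -
    have sub: "cball 0 \<rho> \<subseteq> ball (0::complex) 1" using that by auto
    have cont: "continuous_on (cball 0 \<rho>) h"
      using h(1) sub holomorphic_on_imp_continuous_on holomorphic_on_subset by blast
    have cont': "continuous_on (sphere 0 1) (\<lambda>z. h (of_real \<rho> * z))"
      using that by (intro continuous_on_compose2[OF cont] continuous_intros) (auto simp: norm_mult)
    have "h holomorphic_on ball 0 \<rho>"
      using h(1) sub holomorphic_on_subset ball_subset_cball by blast
    then have "circle_mean (\<lambda>z. h (\<rho> * z)) = h 0"
      using circle_mean_Cauchy[OF cont, of 0] that by simp
    then have "norm (h 0) \<le> circle_mean (\<lambda>z. norm (h (\<rho> * z)))"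
      using norm_circle_mean_le[OF cont' continuous_on_norm[OF cont']] by simp
    also have "\<dots> = circle_mean (\<lambda>z. sqrt (norm (f (\<rho> * z))))"
      using that by (intro circle_mean_cong norm_h) (auto simp: norm_mult)
    finally show ?thesis .
  qed
  have contf: "continuous_on UNIV f"
    by (rule holomorphic_on_imp_continuous_on) (rule f_hol)
  have "continuous_on (closure {0<..<1::real}) (\<lambda>\<rho>. circle_mean (\<lambda>z. sqrt (norm (f (\<rho> * z)))))"
  proof (rule continuous_on_circle_mean)
    have "continuous_on (closure {0<..<1::real} \<times> sphere 0 1) (\<lambda>x. f (of_real (fst x) * snd x))"
      by (rule continuous_on_compose2[OF contf]) (auto intro!: continuous_intros)
    then show "continuous_on (closure {0<..<1::real} \<times> sphere 0 1) (\<lambda>(\<rho>::real, z). sqrt (norm (f (of_real \<rho> * z))))"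
      by (simp add: case_prod_beta continuous_on_real_sqrt continuous_on_norm)
  qed
  from continuous_ge_on_closure[OF this, of 1 "norm (h 0)"] interior
  have "norm (h 0) \<le> circle_mean (\<lambda>z. sqrt (norm (f z)))" by simp
  also have "\<dots> = circle_mean (\<lambda>z. sqrt (norm (poly p z)))"
    by (intro circle_mean_cong) (simp add: norm_f)
  finally show ?thesis using * by simp
qed simp

section \<open>A smooth modulus with bounded gradient; polynomial sums\<close>

definition soft_norm :: "complex \<Rightarrow> real" where
  "soft_norm s = sqrt (1 + (norm s)\<^sup>2)"

text \<open>
  The gradient of \<^const>\<open>soft_norm\<close>.
\<close>

definition soft_sgn :: "complex \<Rightarrow> complex" where
  "soft_sgn s = s / of_real (soft_norm s)"

lemma soft_norm_ge_1: "1 \<le> soft_norm s"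
  by (simp add: soft_norm_def)

lemma soft_norm_pos [simp]: "0 < soft_norm s"
  using soft_norm_ge_1[of s] by linarith

lemma soft_norm_squared: "(soft_norm s)\<^sup>2 = 1 + (norm s)\<^sup>2"
  by (simp add: soft_norm_def)

lemma norm_le_soft_norm: "norm s \<le> soft_norm s"
  by (rule power2_le_imp_le) (simp_all add: soft_norm_squared less_imp_le)

lemma soft_norm_le: "soft_norm s \<le> 1 + (norm s)\<^sup>2 / 2"
proof (rule power2_le_imp_le)
  have "(1 + x / 2)\<^sup>2 = 1 + x + (x / 2)\<^sup>2" for x :: real
    by (simp add: power2_eq_square algebra_simps)
  then show "(soft_norm s)\<^sup>2 \<le> (1 + (norm s)\<^sup>2 / 2)\<^sup>2" by (simp add: soft_norm_squared)
qed simp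

lemma norm_soft_sgn_le: "norm (soft_sgn s) \<le> 1"
  using norm_le_soft_norm[of s] by (simp add: soft_sgn_def norm_divide less_imp_le)

lemma continuous_soft_norm [continuous_intros]:
  "continuous_on A f \<Longrightarrow> continuous_on A (\<lambda>x. soft_norm (f x))"
  unfolding soft_norm_def by (intro continuous_intros)

lemma continuous_soft_sgn [continuous_intros]:
  "continuous_on A f \<Longrightarrow> continuous_on A (\<lambda>x. soft_sgn (f x))"
  unfolding soft_sgn_def by (intro continuous_intros) (auto simp: less_imp_neq[symmetric])

text \<open>
  The arithmetic-geometric mean inequality applied to the two soft norms.
\<close>

lemma soft_norm_upper:
  "soft_norm (s + d) \<le> soft_norm s + Re (cnj (soft_sgn s) * d) + (norm d)\<^sup>2 / 2"
proof -
  define X Y where "X = soft_norm s" and "Y = soft_norm (s + d)"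
  have X: "X > 0" "X \<ge> 1" by (simp_all add: X_def soft_norm_ge_1)
  have "Y\<^sup>2 = X\<^sup>2 + 2 * Re (cnj s * d) + (norm d)\<^sup>2"
    unfolding X_def Y_def soft_norm_squared cmod_power2 by (simp add: power2_eq_square algebra_simps)
  moreover have "0 \<le> (X - Y)\<^sup>2" by simp
  ultimately have "2 * X * Y \<le> 2 * X\<^sup>2 + 2 * Re (cnj s * d) + (norm d)\<^sup>2" 
    by (simp add: power2_diff)
  then have "Y \<le> (2 * X\<^sup>2 + 2 * Re (cnj s * d) + (norm d)\<^sup>2) / (2 * X)"
    using X by (simp add: pos_le_divide_eq mult_ac)
  also have "\<dots> = X + Re (cnj s * d) / X + (norm d)\<^sup>2 / (2 * X)"
    using X by (simp add: field_simps power2_eq_square)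
  also have "Re (cnj s * d) / X = Re (cnj (soft_sgn s) * d)"
    using X by (simp add: soft_sgn_def X_def[symmetric] add_divide_distrib diff_divide_distrib)
  also have "(norm d)\<^sup>2 / (2 * X) \<le> (norm d)\<^sup>2 / 2"
    using X by (intro divide_left_mono) auto
  finally show ?thesis by (simp add: X_def Y_def)
qed

text \<open>
  A quantitative strict convexity. With \<open>X\<close>, \<open>Y\<close> the soft norms of \<open>s\<close>, \<open>s'\<close> and
  \<open>R = 1 + Re (cnj s * s')\<close>, the excess over the tangent is \<open>(X * Y - R) / X\<close>, and Lagrange's
  identity bounds \<open>(X * Y)\<^sup>2 - R\<^sup>2\<close> below by the square of the distance.
\<close>

lemma soft_norm_lower:
  "soft_norm s + Re (cnj (soft_sgn s) * (s' - s)) + (norm (s' - s))\<^sup>2 / (2 * (soft_norm s)\<^sup>2 * soft_norm s')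
     \<le> soft_norm s'"
proof -
  define X Y R where "X = soft_norm s" and "Y = soft_norm s'" and "R = 1 + Re (cnj s * s')"
  have X: "X > 0" "Y > 0" by (simp_all add: X_def Y_def)
  have "(X * Y)\<^sup>2 = (1 + (norm s)\<^sup>2) * (1 + (norm s')\<^sup>2)"
    by (simp add: power_mult_distrib X_def Y_def soft_norm_squared)
  also have "\<dots> = R\<^sup>2 + (norm (s' - s))\<^sup>2 + (Im (cnj s * s'))\<^sup>2"
    unfolding R_def cmod_power2 by (simp add: power2_eq_square algebra_simps)
  finally have diff: "(X * Y)\<^sup>2 - R\<^sup>2 = (norm (s' - s))\<^sup>2 + (Im (cnj s * s'))\<^sup>2"
    by linarith
  have "(X * Y - R) * (X * Y + R) = (X * Y)\<^sup>2 - R\<^sup>2" 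
    by (simp add: power2_eq_square algebra_simps)
  with diff have 1: "(norm (s' - s))\<^sup>2 \<le> (X * Y - R) * (X * Y + R)"
    using zero_le_power2[of "Im (cnj s * s')"] by linarith
  have "R\<^sup>2 \<le> (X * Y)\<^sup>2" 
    using diff zero_le_power2[of "Im (cnj s * s')"] zero_le_power2[of "norm (s' - s)"] by linarith
  then have "\<bar>R\<bar> \<le> \<bar>X * Y\<bar>" by (simp only: abs_le_square_iff)
  then have "\<bar>R\<bar> \<le> X * Y" using X by simp
  then have "(X * Y - R) * (X * Y + R) \<le> (X * Y - R) * (2 * (X * Y))"
    by (intro mult_left_mono) auto
  with 1 have "(norm (s' - s))\<^sup>2 / (2 * (X * Y)) \<le> X * Y - R"
    using X by (simp add: pos_divide_le_eq)
  then have "(norm (s' - s))\<^sup>2 / (2 * (X * Y)) / X \<le> (X * Y - R) / X"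
    using X by (intro divide_right_mono) auto
  moreover have "(X * Y - R) / X = Y - X - Re (cnj (soft_sgn s) * (s' - s))"
  proof -
    have "Re (cnj (soft_sgn s) * (s' - s)) = Re (cnj s * (s' - s)) / X"
      by (simp add: soft_sgn_def X_def[symmetric] add_divide_distrib diff_divide_distrib)
    also have "Re (cnj s * (s' - s)) = R - X\<^sup>2"
      unfolding R_def X_def soft_norm_squared cmod_power2 by (simp add: power2_eq_square algebra_simps)
    finally show ?thesis using X by (simp add: field_simps power2_eq_square)
  qed
  ultimately show ?thesis
    by (simp add: X_def Y_def power2_eq_square mult_ac)
qed

definition pol :: "nat \<Rightarrow> (nat \<Rightarrow> complex) \<Rightarrow> complex \<Rightarrow> complex" where
  "pol K c z = (\<Sum>m<K. c m * z ^ m)"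

lemma continuous_pol [continuous_intros]: 
  "continuous_on A f \<Longrightarrow> continuous_on A (\<lambda>x. pol K c (f x))"
  unfolding pol_def by (intro continuous_intros)

lemma circle_mean_pol_coeff:
  assumes "m < K"
  shows "circle_mean (\<lambda>z. pol K c z * cnj z ^ m) = c m"
proof -
  have "circle_mean (\<lambda>z. pol K c z * cnj z ^ m) = circle_mean (\<lambda>z. \<Sum>i<K. c i * (z ^ i * cnj z ^ m))"
    by (simp add: pol_def sum_distrib_right mult.assoc)
  also have "\<dots> = (\<Sum>i<K. c i * circle_mean (\<lambda>z. z ^ i * cnj z ^ m))"
    by (subst circle_mean_sum) (auto intro!: continuous_intros sum.cong circle_mean_mult_left)
  also have "\<dots> = (\<Sum>i<K. if i = m then c i else 0)" 
    by (intro sum.cong) (auto simp: circle_mean_monomials)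
  also have "\<dots> = c m" using assms by simp
  finally show ?thesis .
qed

lemma circle_mean_norm_pol_squared:
  "circle_mean (\<lambda>z. (norm (pol K c z))\<^sup>2) = (\<Sum>m<K. (norm (c m))\<^sup>2)"
proof -
  have sq: "complex_of_real ((norm (pol K c z))\<^sup>2) = (\<Sum>m<K. cnj (c m) * (pol K c z * cnj z ^ m))" for z
    unfolding complex_norm_square pol_def cnj_sum sum_distrib_left by (intro sum.cong) auto
  have "complex_of_real (circle_mean (\<lambda>z. (norm (pol K c z))\<^sup>2)) 
      = circle_mean (\<lambda>z. complex_of_real ((norm (pol K c z))\<^sup>2))"
    by (rule circle_mean_of_real[symmetric]) (intro continuous_intros)
  also have "\<dots> = circle_mean (\<lambda>z. \<Sum>m<K. cnj (c m) * (pol K c z * cnj z ^ m))"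
    unfolding sq ..
  also have "\<dots> = (\<Sum>m<K. cnj (c m) * circle_mean (\<lambda>z. pol K c z * cnj z ^ m))"
    by (subst circle_mean_sum) (auto intro!: continuous_intros sum.cong circle_mean_mult_left)
  also have "\<dots> = (\<Sum>m<K. complex_of_real ((norm (c m))\<^sup>2))"
    unfolding complex_norm_square by (intro sum.cong) (simp_all add: circle_mean_pol_coeff)
  also have "\<dots> = complex_of_real (\<Sum>m<K. (norm (c m))\<^sup>2)" by simp
  finally show ?thesis using of_real_eq_iff by blast
qed

text \<open>
  Jensen's inequality for a fixed top index \<open>K\<close> in place of the degree; where \<open>c K\<close> vanishes it is trivial.
\<close>

lemma sqrt_norm_top_coeff_le:
  "sqrt (norm (c K)) \<le> circle_mean (\<lambda>z. sqrt (norm (pol (Suc K) c z)))"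
proof (cases "c K = 0")
  case True
  have "circle_mean (\<lambda>z. 0) \<le> circle_mean (\<lambda>z. sqrt (norm (pol (Suc K) c z)))"
    by (intro circle_mean_mono continuous_intros) auto
  then show ?thesis using True by simp
next
  case False
  define p where "p = (\<Sum>m<Suc K. monom (c m) m)"
  have coeff: "coeff p i = (if i \<le> K then c i else 0)" for i
    by (auto simp: p_def coeff_sum coeff_monom less_Suc_eq_le sum.delta)
  have "degree p = K"
    using False by (intro antisym degree_le le_degree) (auto simp: coeff)
  then have "lead_coeff p = c K" by (simp add: coeff)
  moreover have "poly p = pol (Suc K) c" by (simp add: fun_eq_iff p_def pol_def poly_sum poly_monom)
  ultimately show ?thesis using sqrt_norm_lead_coeff_le_circle_mean[of p] by simp
qed

lemma sum_sum_diff_index: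
  fixes h :: "nat \<Rightarrow> complex"
  shows "(\<Sum>j<n. \<Sum>k\<le>j. h (j - k)) = (\<Sum>l<n. of_nat (n - l) * h l)"
proof (induction n)
  case (Suc n)
  have diag: "(\<Sum>k\<le>n. h (n - k)) = (\<Sum>l\<le>n. h l)"
    using sum.nat_diff_reindex[of h "Suc n"] by (simp only: lessThan_Suc_atMost diff_Suc_Suc)
  have "(\<Sum>l<Suc n. of_nat (Suc n - l) * h l) = (\<Sum>l\<le>n. of_nat (n - l) * h l + h l)"
    unfolding lessThan_Suc_atMost by (intro sum.cong) (auto simp: Suc_diff_le distrib_right)
  also have "\<dots> = (\<Sum>l<n. of_nat (n - l) * h l) + (\<Sum>l\<le>n. h l)"
    by (simp add: sum.distrib flip: lessThan_Suc_atMost)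
  finally show ?case by (simp only: sum.lessThan_Suc Suc diag)
qed simp

text \<open>
  The double sum is the convolution of \<open>f\<close> with the square of the modulus of the Dirichlet
  kernel, a positive kernel of mean \<open>n\<close>; that is, it is \<open>n\<close> times a Fejer mean of \<open>f\<close>.
\<close>

lemma fejer_bound:
  assumes f: "continuous_on (sphere 0 1) f" "\<And>s. norm s = 1 \<Longrightarrow> norm (f s) \<le> 1"
    and z: "norm z = 1"
  shows "norm (\<Sum>j<n. \<Sum>k<n. z ^ j * cnj z ^ k * circle_mean (\<lambda>s. f s * (cnj s ^ j * s ^ k))) \<le> n"
proof -
  define P where "P = pol n (\<lambda>k. cnj z ^ k)"
  have P: "cnj (P s) * P s = (\<Sum>j<n. \<Sum>k<n. z ^ j * cnj z ^ k * (cnj s ^ j * s ^ k))" for s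
    unfolding P_def pol_def cnj_sum sum_product by (simp add: mult_ac)
  have cont: "continuous_on (sphere 0 1) (\<lambda>s. c * (f s * (cnj s ^ j * s ^ k)))" for c j k
    by (intro continuous_intros f)
  from cont[of 1] have cont1: "continuous_on (sphere 0 1) (\<lambda>s. f s * (cnj s ^ j * s ^ k))" for j k
    by simp
  have "(\<Sum>j<n. \<Sum>k<n. z ^ j * cnj z ^ k * circle_mean (\<lambda>s. f s * (cnj s ^ j * s ^ k)))
      = circle_mean (\<lambda>s. \<Sum>j<n. \<Sum>k<n. z ^ j * cnj z ^ k * (f s * (cnj s ^ j * s ^ k)))"
    by (subst circle_mean_sum, simp, intro continuous_on_sum cont, intro sum.cong refl)
      (subst circle_mean_sum, simp, rule cont, intro sum.cong refl circle_mean_mult_left[symmetric] cont1)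
  also have "\<dots> = circle_mean (\<lambda>s. f s * (cnj (P s) * P s))"
    unfolding P by (simp only: sum_distrib_left mult.left_commute[of "f _"])
  also have "norm \<dots> \<le> circle_mean (\<lambda>s. (norm (P s))\<^sup>2)"
  proof (rule norm_circle_mean_le)
    fix s :: complex assume "norm s = 1"
    then show "norm (f s * (cnj (P s) * P s)) \<le> (norm (P s))\<^sup>2"
      using f(2)[of s] mult_right_mono[of "norm (f s)" 1 "(norm (P s))\<^sup>2"]
      by (simp add: norm_mult power2_eq_square)
  qed (use f in \<open>auto simp: P_def intro!: continuous_intros\<close>)
  also have "\<dots> = n"
    unfolding P_def circle_mean_norm_pol_squared using z by (simp add: norm_power)
  finally show ?thesis .
qed

section \<open>The extremal problem of prescribed upper coefficients\<close>

text \<open>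
  Data \<open>g\<close> with frequencies \<open>0..<n\<close> and corrections \<open>u\<close> with frequencies \<open>-n..<0\<close>, both multiplied
  by \<open>z ^ n\<close>. The shift leaves the modulus on the circle unchanged and lets ordinary polynomials
  take the place of trigonometric ones.
\<close>

definition extend :: "nat \<Rightarrow> (nat \<Rightarrow> complex) \<Rightarrow> (nat \<Rightarrow> complex) \<Rightarrow> nat \<Rightarrow> complex" where
  "extend n g u m = (if m < n then u m else g (m - n))"

definition energy :: "nat \<Rightarrow> (nat \<Rightarrow> complex) \<Rightarrow> (nat \<Rightarrow> complex) \<Rightarrow> real" where
  "energy n g u = circle_mean (\<lambda>z. soft_norm (pol (2 * n) (extend n g u) z))"

lemma continuous_on_energy: "continuous_on UNIV (energy n g)"
proof -
  have "continuous_on UNIV (\<lambda>u. circle_mean (\<lambda>z. soft_norm (pol (2 * n) (extend n g u) z)))"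
  proof (rule continuous_on_circle_mean)
    have "continuous_on (UNIV \<times> sphere 0 1) (\<lambda>x. extend n g (fst x) m)" for m
      unfolding extend_def
      by (cases "m < n")
        (simp_all add: continuous_on_product_then_coordinatewise continuous_on_fst)
    then have "continuous_on (UNIV \<times> sphere 0 1) (\<lambda>x. pol (2 * n) (extend n g (fst x)) (snd x))"
      unfolding pol_def by (intro continuous_intros)
    then show "continuous_on (UNIV \<times> sphere 0 1) (\<lambda>(u, z). soft_norm (pol (2 * n) (extend n g u) z))"
      unfolding case_prod_beta by (rule continuous_soft_norm)
  qed
  then show ?thesis by (simp add: energy_def[abs_def])
qed

text \<open>
  This is coercivity of the energy in the free coefficients.
\<close>

lemma coeff_le_energy:
  assumes "m < n"
  shows "norm (u m) \<le> energy n g u"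
proof -
  have "u m = circle_mean (\<lambda>z. pol (2 * n) (extend n g u) z * cnj z ^ m)"
    using assms by (subst circle_mean_pol_coeff) (simp_all add: extend_def)
  also have "norm \<dots> \<le> energy n g u"
    unfolding energy_def
    by (rule norm_circle_mean_le)
      (auto intro!: continuous_intros simp: norm_mult norm_power norm_le_soft_norm)
  finally show ?thesis .
qed

text \<open>
  The energy is continuous for the product topology, and corrections with a coefficient larger than
  the energy at the zero correction cannot compete, so it suffices to minimise over a product of discs.
\<close>

lemma energy_minimizer_exists: "\<exists>u. \<forall>u'. energy n g u \<le> energy n g u'"
proof -
  define R where "R = energy n g (\<lambda>m. 0)"
  define S where "S = PiE UNIV (\<lambda>m. if m < n then cball (0::complex) R else {0})"
  have "R \<ge> 0"
    unfolding R_def energy_def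
  proof -
    have "circle_mean (\<lambda>z. 0) \<le> circle_mean (\<lambda>z. soft_norm (pol (2 * n) (extend n g (\<lambda>m. 0)) z))"
      by (intro circle_mean_mono continuous_intros) (simp add: less_imp_le)
    then show "0 \<le> circle_mean (\<lambda>z. soft_norm (pol (2 * n) (extend n g (\<lambda>m. 0)) z))" by simp
  qed
  have "compactin (product_topology (\<lambda>m. euclidean) UNIV) S"
    unfolding S_def by (subst compactin_PiE) auto
  then have "compact S" by (simp add: euclidean_product_topology)
  moreover have zero: "(\<lambda>m. 0) \<in> S" using \<open>R \<ge> 0\<close> by (auto simp: S_def)
  ultimately obtain u where u: "u \<in> S" "\<And>u'. u' \<in> S \<Longrightarrow> energy n g u \<le> energy n g u'"
    using continuous_attains_inf[of S "energy n g"] continuous_on_subset[OF continuous_on_energy]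
    by blast
  have "energy n g u \<le> energy n g u'" for u'
  proof (cases "\<forall>m<n. norm (u' m) \<le> R")
    case True
    then have "(\<lambda>m. if m < n then u' m else 0) \<in> S" by (auto simp: S_def)
    moreover have "extend n g (\<lambda>m. if m < n then u' m else 0) = extend n g u'"
      by (simp add: fun_eq_iff extend_def)
    ultimately show ?thesis using u(2)[of "\<lambda>m. if m < n then u' m else 0"] by (simp add: energy_def)
  next
    case False
    then obtain m where "m < n" "norm (u' m) > R" by auto
    with coeff_le_energy[of m n u' g] u(2)[OF zero] show ?thesis by (simp add: R_def)
  qed
  then show ?thesis by blast
qed

definition min_ext :: "nat \<Rightarrow> (nat \<Rightarrow> complex) \<Rightarrow> nat \<Rightarrow> complex" where
  "min_ext n g = extend n g (SOME u. \<forall>u'. energy n g u \<le> energy n g u')"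

definition min_energy :: "nat \<Rightarrow> (nat \<Rightarrow> complex) \<Rightarrow> real" where
  "min_energy n g = circle_mean (\<lambda>z. soft_norm (pol (2 * n) (min_ext n g) z))"

text \<open>
  The Fourier coefficients of the gradient of the minimal energy; the index is counted from the bottom
  frequency of the data.
\<close>

definition dual_coeff :: "nat \<Rightarrow> (nat \<Rightarrow> complex) \<Rightarrow> nat \<Rightarrow> complex" where
  "dual_coeff n g l = circle_mean (\<lambda>z. soft_sgn (pol (2 * n) (min_ext n g) z) * cnj z ^ (n + l))"

lemma min_energy_le: "min_energy n g \<le> energy n g u"
  using someI_ex[OF energy_minimizer_exists[of n g]] 
  by (simp add: min_energy_def min_ext_def energy_def)

text \<open>
  Compare with the zero correction and use Parseval's identity.
\<close>

lemma min_energy_bound: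
  assumes "(\<Sum>l<n. (norm (g l))\<^sup>2) \<le> 1"
  shows "min_energy n g \<le> 3 / 2"
proof -
  define c where "c = extend n g (\<lambda>m. 0)"
  have "min_energy n g \<le> circle_mean (\<lambda>z. soft_norm (pol (2 * n) c z))"
    using min_energy_le[of n g "\<lambda>m. 0"] by (simp add: energy_def c_def)
  also have "\<dots> \<le> circle_mean (\<lambda>z. 1 + 1 / 2 * (norm (pol (2 * n) c z))\<^sup>2)"
    by (intro circle_mean_mono continuous_intros) (use soft_norm_le in simp)
  also have "\<dots> = 1 + 1 / 2 * (\<Sum>m<2 * n. (norm (c m))\<^sup>2)"
    by (subst circle_mean_add; (intro continuous_intros)?; subst circle_mean_mult_left; 
        (intro continuous_intros)?; simp add: circle_mean_norm_pol_squared)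
  also have "(\<Sum>m<2 * n. (norm (c m))\<^sup>2) = (\<Sum>m\<in>{n..<n + n}. (norm (c m))\<^sup>2)"
    by (rule sum.mono_neutral_right) (auto simp: c_def extend_def)
  also have "\<dots> = (\<Sum>l<n. (norm (g l))\<^sup>2)"
    by (rule sum.reindex_bij_witness[of _ "\<lambda>l. n + l" "\<lambda>m. m - n"]) (auto simp: c_def extend_def)
  finally show ?thesis using assms by simp
qed

text \<open>
  The Euler equation of the minimiser. Moving the correction by \<open>- \<kappa> * z ^ m\<close>, where \<open>\<kappa>\<close> is the coefficient
  in question, changes the energy by at most \<open>- (norm \<kappa>)\<^sup>2 + (norm \<kappa>)\<^sup>2 / 2\<close>, which is negative unless
  \<open>\<kappa> = 0\<close>.
\<close>

lemma dual_stationary: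
  assumes "m < n"
  shows "circle_mean (\<lambda>z. soft_sgn (pol (2 * n) (min_ext n g) z) * cnj z ^ m) = 0"
proof -
  define w where "w = pol (2 * n) (min_ext n g)"
  define \<kappa> where "\<kappa> = circle_mean (\<lambda>z. soft_sgn (w z) * cnj z ^ m)"
  have w_cont: "continuous_on A w" for A
    unfolding w_def by (intro continuous_intros)
  note cont = continuous_intros continuous_soft_norm continuous_soft_sgn w_cont
  obtain u where u: "min_ext n g = extend n g u" by (simp add: min_ext_def)
  have upd: "pol (2 * n) (extend n g (u(m := u m - \<kappa>))) z = w z + (- \<kappa> * z ^ m)" for z
  proof -
    have "pol (2 * n) (extend n g (u(m := u m - \<kappa>))) z 
        = (\<Sum>i<2*n. extend n g u i * z ^ i + (if i = m then - \<kappa> * z ^ m else 0))"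
      unfolding pol_def by (intro sum.cong) (use assms in \<open>auto simp: extend_def algebra_simps\<close>)
    also have "\<dots> = w z + (- \<kappa> * z ^ m)"
      unfolding sum.distrib w_def pol_def u using assms by simp
    finally show ?thesis .
  qed
  have "Re (cnj a * (- \<kappa> * Z)) = - Re (cnj \<kappa> * (a * cnj Z))" for a Z
    by (simp add: algebra_simps)
  then have Re_lin: "Re (cnj a * (- \<kappa> * z ^ m)) = - Re (cnj \<kappa> * (a * cnj z ^ m))" for a z
    by (simp only: complex_cnj_power)
  have "min_energy n g \<le> circle_mean (\<lambda>z. soft_norm (w z + (- \<kappa> * z ^ m)))"
    using min_energy_le[of n g "u(m := u m - \<kappa>)"] by (simp add: energy_def upd)
  also have "\<dots> \<le> circle_mean (\<lambda>z. (soft_norm (w z) + (norm \<kappa>)\<^sup>2 / 2) 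
                    + (-1) * Re (cnj \<kappa> * (soft_sgn (w z) * cnj z ^ m)))"
  proof (intro circle_mean_mono cont)
    fix z :: complex assume "norm z = 1"
    then show "soft_norm (w z + (- \<kappa> * z ^ m)) \<le> (soft_norm (w z) + (norm \<kappa>)\<^sup>2 / 2) 
                    + (-1) * Re (cnj \<kappa> * (soft_sgn (w z) * cnj z ^ m))"
      using soft_norm_upper[of "w z" "- \<kappa> * z ^ m"] unfolding Re_lin
      by (simp add: norm_mult norm_power)
  qed
  also have "\<dots> = min_energy n g + (norm \<kappa>)\<^sup>2 / 2 - Re (cnj \<kappa> * \<kappa>)"
    by (subst circle_mean_add; (intro cont)?; subst circle_mean_add; (intro cont)?;
        subst circle_mean_mult_left; (intro cont)?; subst circle_mean_Re; (intro cont)?;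
        subst circle_mean_mult_left; (intro cont)?; simp add: \<kappa>_def w_def min_energy_def)
  also have "Re (cnj \<kappa> * \<kappa>) = (norm \<kappa>)\<^sup>2"
    by (simp add: cmod_power2 flip: power2_eq_square)
  finally show ?thesis by (simp add: \<kappa>_def w_def)
qed

text \<open>
  The Fejer mean of order \<open>n\<close> of the gradient has frequencies in \<open>-n<..<n\<close>; the negative ones vanish by
  stationarity, so that only the displayed polynomial remains.
\<close>

lemma dual_polynomial_bound:
  assumes "norm z = 1"
  shows "norm (\<Sum>l<n. of_nat (n - l) * dual_coeff n g l * z ^ l) \<le> n"
proof -
  define w where "w = pol (2 * n) (min_ext n g)"
  have w_cont: "continuous_on A w" for A
    unfolding w_def by (intro continuous_intros)
  define f where "f s = soft_sgn (w s) * cnj s ^ n" for s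
  have f: "continuous_on (sphere 0 1) f" 
    unfolding f_def by (intro continuous_intros continuous_soft_sgn w_cont)
  have f1: "norm (f s) \<le> 1" if "norm s = 1" for s
    using that by (simp add: f_def norm_mult norm_power norm_soft_sgn_le)
  have unit: "s ^ k * cnj s ^ k = 1" if "norm s = 1" for s :: complex and k
    using that complex_norm_square[of s] by (simp flip: power_mult_distrib)
  have low: "circle_mean (\<lambda>s. f s * (cnj s ^ j * s ^ k)) = 0" if "j < k" "k < n" for j k
  proof -
    have "f s * (cnj s ^ j * s ^ k) = soft_sgn (w s) * cnj s ^ (n + j - k)" if "norm s = 1" for s
    proof -
      have "cnj s ^ n * cnj s ^ j = cnj s ^ (n + j - k) * cnj s ^ k"
        using \<open>k < n\<close> by (simp flip: power_add)
      note eq = this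
      have "f s * (cnj s ^ j * s ^ k) = soft_sgn (w s) * (cnj s ^ n * cnj s ^ j) * s ^ k"
        by (simp add: f_def)
      also have "\<dots> = soft_sgn (w s) * cnj s ^ (n + j - k) * (s ^ k * cnj s ^ k)"
        unfolding eq by simp
      finally show ?thesis unfolding unit[OF that] by simp
    qed
    then have "circle_mean (\<lambda>s. f s * (cnj s ^ j * s ^ k)) = circle_mean (\<lambda>s. soft_sgn (w s) * cnj s ^ (n + j - k))"
      by (rule circle_mean_cong)
    also have "\<dots> = 0"
      unfolding w_def using that by (intro dual_stationary) auto
    finally show ?thesis .
  qed
  have high: "circle_mean (\<lambda>s. f s * (cnj s ^ j * s ^ k)) = dual_coeff n g (j - k)" if "k \<le> j" for j k
  proof -
    have "f s * (cnj s ^ j * s ^ k) = soft_sgn (w s) * cnj s ^ (n + (j - k))" if "norm s = 1" for s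
    proof -
      have "cnj s ^ n * cnj s ^ j = cnj s ^ (n + (j - k)) * cnj s ^ k"
        using \<open>k \<le> j\<close> by (simp flip: power_add)
      note eq = this
      have "f s * (cnj s ^ j * s ^ k) = soft_sgn (w s) * (cnj s ^ n * cnj s ^ j) * s ^ k"
        by (simp add: f_def)
      also have "\<dots> = soft_sgn (w s) * cnj s ^ (n + (j - k)) * (s ^ k * cnj s ^ k)"
        unfolding eq by simp
      finally show ?thesis unfolding unit[OF that] by simp
    qed
    then show ?thesis
      unfolding dual_coeff_def w_def[symmetric] by (rule circle_mean_cong)
  qed
  have zz: "z ^ j * cnj z ^ k = z ^ (j - k)" if "k \<le> j" for j k
  proof -
    have "z ^ j = z ^ (j - k) * z ^ k" using that by (simp flip: power_add)
    then show ?thesis using unit[OF assms, of k] by (simp add: mult.assoc)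
  qed
  have "(\<Sum>l<n. of_nat (n - l) * dual_coeff n g l * z ^ l) 
      = (\<Sum>j<n. \<Sum>k\<le>j. dual_coeff n g (j - k) * z ^ (j - k))"
    by (subst sum_sum_diff_index) (simp add: mult.assoc)
  also have "\<dots> = (\<Sum>j<n. \<Sum>k<n. z ^ j * cnj z ^ k * circle_mean (\<lambda>s. f s * (cnj s ^ j * s ^ k)))"
  proof (rule sum.cong[OF refl])
    fix j assume "j \<in> {..<n}"
    then show "(\<Sum>k\<le>j. dual_coeff n g (j - k) * z ^ (j - k)) 
      = (\<Sum>k<n. z ^ j * cnj z ^ k * circle_mean (\<lambda>s. f s * (cnj s ^ j * s ^ k)))"
      by (intro sum.mono_neutral_cong_left) (auto simp: low high zz)
  qed
  finally show ?thesis using fejer_bound[OF f f1 assms, of n] by simp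
qed

section \<open>Second-order gain of the minimal energy\<close>

text \<open>
  For every \<open>\<theta> > 0\<close> and \<open>X = sqrt (norm D)\<close> one has \<open>X \<le> \<theta> ^ 3 * X ^ 4 / T ^ 3 + T / \<theta>\<close>: either
  \<open>X \<le> T / \<theta>\<close>, or \<open>\<theta> * X / T\<close> exceeds 1 and so does its cube. Taking means, bounding the left side from
  below by Jensen's inequality and choosing \<open>\<theta>\<close> so that the last term is half of that bound
  gives the claim. The exponent \<open>1 / 2\<close> is what makes the first power of \<open>T\<close> suffice.
\<close>

lemma circle_mean_weighted_lower_bound:
  assumes "continuous_on (sphere 0 1) T" "\<And>z. norm z = 1 \<Longrightarrow> T z > 0" "circle_mean T \<le> 3"
  shows "(norm (c K))\<^sup>2 / 432 \<le> circle_mean (\<lambda>z. (norm (pol (Suc K) c z))\<^sup>2 / T z ^ 3)"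
proof (cases "c K = 0")
  case True
  have "circle_mean (\<lambda>z. 0) \<le> circle_mean (\<lambda>z. (norm (pol (Suc K) c z))\<^sup>2 / T z ^ 3)"
    using assms(2) by (intro circle_mean_mono continuous_intros assms(1)) force+
  then show ?thesis using True by simp
next
  case False
  define x where "x = sqrt (norm (c K))"
  have x: "x > 0" "x ^ 4 = (norm (c K))\<^sup>2" 
    using False by (simp_all add: x_def power4_eq_xxxx power2_eq_square)
  define \<theta> where "\<theta> = 6 / x"
  have \<theta>: "\<theta> > 0" using x by (simp add: \<theta>_def)
  define Q where "Q = (\<lambda>z. (norm (pol (Suc K) c z))\<^sup>2 / T z ^ 3)"
  have Q: "continuous_on (sphere 0 1) Q"
    unfolding Q_def using assms(2) by (intro continuous_intros assms(1)) force
  have "x \<le> circle_mean (\<lambda>z. sqrt (norm (pol (Suc K) c z)))"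
    unfolding x_def by (rule sqrt_norm_top_coeff_le)
  also have "\<dots> \<le> circle_mean (\<lambda>z. \<theta> ^ 3 * Q z + 1 / \<theta> * T z)"
  proof (intro circle_mean_mono continuous_intros assms(1) Q)
    fix z :: complex assume z: "norm z = 1"
    define X where "X = sqrt (norm (pol (Suc K) c z))"
    have X: "X \<ge> 0" "X ^ 4 = (norm (pol (Suc K) c z))\<^sup>2" 
      by (simp_all add: X_def power4_eq_xxxx power2_eq_square)
    note Tz = assms(2)[OF z]
    have "X \<le> \<theta> ^ 3 * (X ^ 4 / T z ^ 3) + T z / \<theta>"
    proof (cases "X \<le> T z / \<theta>")
      case True
      have "0 \<le> \<theta> ^ 3 * (X ^ 4 / T z ^ 3)" using \<theta> Tz X(1) by simp
      with True show ?thesis by linarith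
    next
      case False
      then have "1 \<le> \<theta> * X / T z" using \<theta> Tz by (simp add: field_simps)
      then have "1 \<le> (\<theta> * X / T z) ^ 3" by (rule one_le_power)
      then have "X * 1 \<le> X * (\<theta> * X / T z) ^ 3" using X(1) by (rule mult_left_mono)
      also have "\<dots> = \<theta> ^ 3 * (X ^ 4 / T z ^ 3)"
        by (simp add: power_divide power_mult_distrib power4_eq_xxxx power3_eq_cube)
      finally have "X \<le> \<theta> ^ 3 * (X ^ 4 / T z ^ 3)" by simp
      moreover have "0 \<le> T z / \<theta>" using Tz \<theta> by simp
      ultimately show ?thesis by linarith
    qed
    then show "sqrt (norm (pol (Suc K) c z)) \<le> \<theta> ^ 3 * Q z + 1 / \<theta> * T z"
      by (simp add: X Q_def X_def[symmetric])
  qed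
  also have "\<dots> = \<theta> ^ 3 * circle_mean Q + 1 / \<theta> * circle_mean T"
    by (simp only: circle_mean_add[OF continuous_on_mult_left[OF Q] continuous_on_mult_left[OF assms(1)]]
        circle_mean_mult_left[OF Q] circle_mean_mult_left[OF assms(1)])
  also have "\<dots> \<le> \<theta> ^ 3 * circle_mean Q + 1 / \<theta> * 3"
    using \<theta> assms(3) by (intro add_left_mono mult_left_mono) auto
  also have "\<dots> = 216 / x ^ 3 * circle_mean Q + x / 2"
    using x by (simp add: \<theta>_def power_divide)
  finally have "x / 2 \<le> 216 / x ^ 3 * circle_mean Q" by linarith
  then have "x ^ 3 * (x / 2) \<le> x ^ 3 * (216 / x ^ 3 * circle_mean Q)"
    using x(1) by (intro mult_left_mono) auto
  also have "\<dots> = 216 * circle_mean Q" using x(1) by simp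
  also have "x ^ 3 * (x / 2) = x ^ 4 / 2" by (simp add: power4_eq_xxxx power3_eq_cube)
  finally show ?thesis unfolding x(2)[symmetric] Q_def by simp
qed

text \<open>
  Strict convexity integrated over the circle. Changing the datum at one frequency also moves the minimiser,
  but the linear term sees only the change of the datum, because the gradient is orthogonal to all
  corrections. The difference of the minimisers has top coefficient \<open>d\<close>: above it the data agree. The quadratic
  term is therefore bounded below whatever the correction does.
\<close>

lemma min_energy_gain:
  assumes "k < n" "min_energy n g \<le> 3 / 2" "min_energy n (g(k := g k + d)) \<le> 3 / 2"
  shows "min_energy n g + Re (dual_coeff n g k * cnj d) + (norm d)\<^sup>2 / 864 
           \<le> min_energy n (g(k := g k + d))"
proof -
  define g' where "g' = g(k := g k + d)"
  define w w' where "w = pol (2 * n) (min_ext n g)" and "w' = pol (2 * n) (min_ext n g')"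
  define e where "e m = min_ext n g' m - min_ext n g m" for m
  have w_cont: "continuous_on A w" "continuous_on A w'" for A
    unfolding w_def w'_def by (intro continuous_intros)+
  have e_zero: "e m = 0" if "m \<ge> n" "m \<noteq> n + k" for m
    using that by (auto simp: e_def min_ext_def extend_def g'_def)
  have e_top: "e (n + k) = d" by (simp add: e_def min_ext_def extend_def g'_def)
  have diff: "w' z - w z = pol (2 * n) e z" for z
    by (simp add: w_def w'_def pol_def e_def sum_subtractf left_diff_distrib)
  have diff': "pol (2 * n) e z = pol (Suc (n + k)) e z" for z
    unfolding pol_def using assms(1) by (intro sum.mono_neutral_right) (auto simp: e_zero)
  define Q where "Q z = (norm (pol (Suc (n + k)) e z))\<^sup>2 / (soft_norm (w z) + soft_norm (w' z)) ^ 3" for z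
  have T_pos: "soft_norm s + soft_norm s' > 0" for s s'
    using soft_norm_pos[of s] soft_norm_pos[of s'] by linarith
  have Q_cont: "continuous_on A Q" for A
    unfolding Q_def by (intro continuous_intros w_cont) (simp add: less_imp_neq[OF T_pos, symmetric])
  have Q_mean: "(norm d)\<^sup>2 / 432 \<le> circle_mean Q"
    unfolding Q_def e_top[symmetric]
  proof (rule circle_mean_weighted_lower_bound)
    have "circle_mean (\<lambda>z. soft_norm (w z) + soft_norm (w' z)) = min_energy n g + min_energy n g'"
      unfolding min_energy_def w_def w'_def by (intro circle_mean_add continuous_intros)
    then show "circle_mean (\<lambda>z. soft_norm (w z) + soft_norm (w' z)) \<le> 3"
      using assms by (simp add: g'_def)
  qed (auto intro!: continuous_intros w_cont T_pos)
  define L where "L z = soft_sgn (w z) * cnj (pol (2 * n) e z)" for z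
  have L_cont: "continuous_on A L" for A
    unfolding L_def by (intro continuous_intros w_cont)
  have "circle_mean L = circle_mean (\<lambda>z. \<Sum>m<2*n. cnj (e m) * (soft_sgn (w z) * cnj z ^ m))"
    unfolding L_def by (rule circle_mean_cong) (simp add: pol_def sum_distrib_left mult.left_commute)
  also have "\<dots> = (\<Sum>m<2*n. cnj (e m) * circle_mean (\<lambda>z. soft_sgn (w z) * cnj z ^ m))"
    by (subst circle_mean_sum) (auto intro!: continuous_intros w_cont sum.cong circle_mean_mult_left)
  also have "\<dots> = (\<Sum>m<2*n. if m = n + k then cnj d * dual_coeff n g k else 0)"
  proof (rule sum.cong[OF refl])
    fix m
    show "cnj (e m) * circle_mean (\<lambda>z. soft_sgn (w z) * cnj z ^ m) 
      = (if m = n + k then cnj d * dual_coeff n g k else 0)"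
      by (cases "m < n") (auto simp: w_def dual_stationary e_top e_zero dual_coeff_def)
  qed
  also have "\<dots> = dual_coeff n g k * cnj d" using assms(1) by (simp add: mult.commute)
  finally have L_mean: "circle_mean L = dual_coeff n g k * cnj d" .
  have ReL: "continuous_on A (\<lambda>z. Re (L z))" for A by (intro continuous_intros L_cont)
  have sw: "continuous_on A (\<lambda>z. soft_norm (w z))" for A by (intro continuous_intros w_cont)
  have "min_energy n g + Re (dual_coeff n g k * cnj d) + (norm d)\<^sup>2 / 864 
      \<le> circle_mean (\<lambda>z. soft_norm (w z)) + circle_mean (\<lambda>z. Re (L z)) + 1 / 2 * circle_mean Q"
    using Q_mean by (simp add: min_energy_def w_def circle_mean_Re[OF L_cont] L_mean)
  also have "\<dots> = circle_mean (\<lambda>z. soft_norm (w z) + Re (L z) + 1 / 2 * Q z)"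
    by (simp only: circle_mean_add[OF continuous_on_add[OF sw ReL] continuous_on_mult_left[OF Q_cont]]
        circle_mean_add[OF sw ReL] circle_mean_mult_left[OF Q_cont])
  also have "\<dots> \<le> circle_mean (\<lambda>z. soft_norm (w' z))"
  proof (intro circle_mean_mono continuous_intros w_cont L_cont Q_cont)
    fix z
    define s s' where "s = w z" and "s' = w' z"
    have "(soft_norm s)\<^sup>2 * soft_norm s' \<le> (soft_norm s + soft_norm s')\<^sup>2 * (soft_norm s + soft_norm s')"
      by (intro mult_mono power_mono) (auto simp: less_imp_le)
    then have "2 * (soft_norm s)\<^sup>2 * soft_norm s' \<le> 2 * (soft_norm s + soft_norm s') ^ 3"
      by (simp add: power3_eq_cube power2_eq_square)
    then have "(norm (s' - s))\<^sup>2 / (2 * (soft_norm s + soft_norm s') ^ 3) 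
        \<le> (norm (s' - s))\<^sup>2 / (2 * (soft_norm s)\<^sup>2 * soft_norm s')"
      using T_pos[of s s'] by (intro divide_left_mono) (auto simp: soft_norm_pos less_imp_neq[symmetric])
    moreover have "Re (L z) = Re (cnj (soft_sgn s) * (s' - s))"
      unfolding L_def diff[symmetric] s_def s'_def by (simp add: algebra_simps)
    moreover have "1 / 2 * Q z = (norm (s' - s))\<^sup>2 / (2 * (soft_norm s + soft_norm s') ^ 3)"
      unfolding Q_def diff'[symmetric] diff[symmetric] s_def s'_def by simp
    ultimately show "soft_norm (w z) + Re (L z) + 1 / 2 * Q z \<le> soft_norm (w' z)"
      using soft_norm_lower[of s s'] unfolding s_def s'_def by linarith
  qed
  finally show ?thesis by (simp add: min_energy_def w'_def g'_def)
qed

section \<open>Polynomials with large coefficients and small maximum\<close>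

text \<open>
  The weights \<open>\<phi>\<close> are the Fejer weights. The signs \<open>\<epsilon>\<close> maximise the sum of the minimal energies of
  \<open>\<epsilon> * \<phi> * y\<close> and of the mirror image with reversed order of coefficients; the former gives a gradient cut
  sharply at the bottom frequency, the latter one cut sharply at the top. Comparing with the signs flipped at
  \<open>k\<close>, the linear terms combine to the coefficient of the sum \<open>p\<close> of the two Fejer means, and at least one of the
  two weights at \<open>k\<close> is at least \<open>1 / 2\<close>, so the quadratic gain is comparable with \<open>(norm (y k))\<^sup>2\<close>.
\<close>

lemma coefficient_majorant_polynomial_unit:
  fixes y :: "nat \<Rightarrow> complex"
  assumes y: "(\<Sum>l<n. (norm (y l))\<^sup>2) \<le> 1"
  shows "\<exists>p. (\<forall>l<n. norm (y l) \<le> 864 * norm (p l)) \<and> (\<forall>z. norm z = 1 \<longrightarrow> norm (pol n p z) \<le> 2)"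
proof (cases "n = 0")
  case False
  define \<phi> where "\<phi> l = real (n - l) / real n" for l
  define g1 where "g1 \<epsilon> l = of_real (\<epsilon> l * \<phi> l) * y l" for \<epsilon> :: "nat \<Rightarrow> real" and l
  define g2 where "g2 \<epsilon> l = (if l < n then of_real (\<epsilon> (n - 1 - l) * \<phi> l) * y (n - 1 - l) else 0)" 
    for \<epsilon> :: "nat \<Rightarrow> real" and l
  define E where "E \<epsilon> = min_energy n (g1 \<epsilon>) + min_energy n (g2 \<epsilon>)" for \<epsilon>
  define S where "S = PiE {..<n} (\<lambda>_. {-1, 1 :: real})"
  have "finite S" unfolding S_def by (intro finite_PiE) auto
  moreover have "(\<lambda>l\<in>{..<n}. 1) \<in> S" by (auto simp: S_def)
  ultimately obtain \<epsilon> where \<epsilon>: "\<epsilon> \<in> S" and max: "\<And>\<epsilon>'. \<epsilon>' \<in> S \<Longrightarrow> E \<epsilon>' \<le> E \<epsilon>"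
    using finite_has_maximal[of "E ` S"] by (force dest: linear[THEN disjE])
  have sign: "\<bar>\<epsilon>' l\<bar> = 1" if "\<epsilon>' \<in> S" "l < n" for \<epsilon>' l
  proof -
    have "\<epsilon>' l \<in> {-1, 1}" using that by (auto simp: S_def PiE_iff)
    then show ?thesis by auto
  qed
  have \<phi>: "0 \<le> \<phi> l" "\<phi> l \<le> 1" for l using False by (auto simp: \<phi>_def)
  have en1: "min_energy n (g1 \<epsilon>') \<le> 3 / 2" if "\<epsilon>' \<in> S" for \<epsilon>'
  proof (rule min_energy_bound)
    have "(\<Sum>l<n. (norm (g1 \<epsilon>' l))\<^sup>2) \<le> (\<Sum>l<n. (norm (y l))\<^sup>2)"
      using sign[OF that] \<phi>
      by (intro sum_mono power_mono) (auto simp: g1_def norm_mult abs_mult intro!: mult_left_le_one_le)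
    with y show "(\<Sum>l<n. (norm (g1 \<epsilon>' l))\<^sup>2) \<le> 1" by simp
  qed
  have en2: "min_energy n (g2 \<epsilon>') \<le> 3 / 2" if "\<epsilon>' \<in> S" for \<epsilon>'
  proof (rule min_energy_bound)
    have "(\<Sum>l<n. (norm (g2 \<epsilon>' l))\<^sup>2) \<le> (\<Sum>l<n. (norm (y (n - Suc l)))\<^sup>2)"
      using sign[OF that] \<phi>
      by (intro sum_mono power_mono) (auto simp: g2_def norm_mult abs_mult intro!: mult_left_le_one_le)
    also have "\<dots> = (\<Sum>l<n. (norm (y l))\<^sup>2)" by (rule sum.nat_diff_reindex)
    finally show "(\<Sum>l<n. (norm (g2 \<epsilon>' l))\<^sup>2) \<le> 1" using y by simp
  qed
  define \<gamma>1 \<gamma>2 where "\<gamma>1 l = \<phi> l * dual_coeff n (g1 \<epsilon>) l" and "\<gamma>2 l = \<phi> l * dual_coeff n (g2 \<epsilon>) l" for l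
  define p where "p l = \<gamma>1 l + \<gamma>2 (n - Suc l)" for l
  have "norm (y k) \<le> 864 * norm (p k)" if k: "k < n" for k
  proof -
    define k' where "k' = n - Suc k"
    have k': "k' < n" using k by (simp add: k'_def)
    define \<epsilon>' where "\<epsilon>' = \<epsilon>(k := - \<epsilon> k)"
    have \<epsilon>': "\<epsilon>' \<in> S" using \<epsilon> k by (force simp: S_def \<epsilon>'_def PiE_iff extensional_def)
    define d1 d2 where "d1 = -2 * of_real (\<epsilon> k * \<phi> k) * y k" and "d2 = -2 * of_real (\<epsilon> k * \<phi> k') * y k"
    have g1': "g1 \<epsilon>' = (g1 \<epsilon>)(k := g1 \<epsilon> k + d1)"
      by (simp add: fun_eq_iff g1_def \<epsilon>'_def d1_def)
    have g2': "g2 \<epsilon>' = (g2 \<epsilon>)(k' := g2 \<epsilon> k' + d2)"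
      using k by (auto simp: fun_eq_iff g2_def \<epsilon>'_def d2_def k'_def)
    have "min_energy n (g1 \<epsilon>) + Re (dual_coeff n (g1 \<epsilon>) k * cnj d1) + (norm d1)\<^sup>2 / 864 \<le> min_energy n (g1 \<epsilon>')"
      unfolding g1' using k en1[OF \<epsilon>] en1[OF \<epsilon>', unfolded g1'] by (rule min_energy_gain)
    moreover have "min_energy n (g2 \<epsilon>) + Re (dual_coeff n (g2 \<epsilon>) k' * cnj d2) + (norm d2)\<^sup>2 / 864 \<le> min_energy n (g2 \<epsilon>')"
      unfolding g2' using k' en2[OF \<epsilon>] en2[OF \<epsilon>', unfolded g2'] by (rule min_energy_gain)
    ultimately have "Re (dual_coeff n (g1 \<epsilon>) k * cnj d1) + Re (dual_coeff n (g2 \<epsilon>) k' * cnj d2) 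
        + (norm d1)\<^sup>2 / 864 + (norm d2)\<^sup>2 / 864 \<le> 0"
      using max[OF \<epsilon>'] unfolding E_def by linarith
    moreover have "Re (dual_coeff n (g1 \<epsilon>) k * cnj d1) + Re (dual_coeff n (g2 \<epsilon>) k' * cnj d2) 
        = -2 * \<epsilon> k * Re (p k * cnj (y k))"
      unfolding d1_def d2_def p_def \<gamma>1_def \<gamma>2_def k'_def[symmetric] by (simp add: algebra_simps)
    moreover have "(norm d1)\<^sup>2 + (norm d2)\<^sup>2 = 4 * ((\<phi> k)\<^sup>2 + (\<phi> k')\<^sup>2) * (norm (y k))\<^sup>2"
      using sign[OF \<epsilon> k] \<phi>
      by (simp add: d1_def d2_def norm_mult abs_mult power_mult_distrib distrib_right)
    ultimately have 1: "4 * ((\<phi> k)\<^sup>2 + (\<phi> k')\<^sup>2) * (norm (y k))\<^sup>2 \<le> 864 * (2 * \<epsilon> k * Re (p k * cnj (y k)))"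
      by linarith
    have "\<phi> k + \<phi> k' = (real n + 1) / real n"
      using k by (simp add: \<phi>_def k'_def of_nat_diff flip: add_divide_distrib)
    then have "1 \<le> \<phi> k + \<phi> k'" using False by simp
    then have "1\<^sup>2 \<le> (\<phi> k + \<phi> k')\<^sup>2" by (intro power_mono) auto
    also have "\<dots> \<le> 2 * ((\<phi> k)\<^sup>2 + (\<phi> k')\<^sup>2)"
      using zero_le_power2[of "\<phi> k - \<phi> k'"] by (simp add: power2_eq_square algebra_simps)
    finally have "2 * (norm (y k))\<^sup>2 \<le> 4 * ((\<phi> k)\<^sup>2 + (\<phi> k')\<^sup>2) * (norm (y k))\<^sup>2"
      by (intro mult_right_mono) auto
    also note 1
    also have "\<epsilon> k * Re (p k * cnj (y k)) \<le> norm (p k) * norm (y k)"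
      using abs_Re_le_cmod[of "p k * cnj (y k)"] abs_le_D1[of "\<epsilon> k * Re (p k * cnj (y k))"] sign[OF \<epsilon> k]
      by (simp add: abs_mult norm_mult del: times_complex.sel)
    then have "864 * (2 * \<epsilon> k * Re (p k * cnj (y k))) \<le> 864 * (2 * (norm (p k) * norm (y k)))"
      by simp
    finally have "norm (y k) * norm (y k) \<le> (864 * norm (p k)) * norm (y k)"
      by (simp add: power2_eq_square)
    then show ?thesis
      by (cases "y k = 0") auto
  qed
  moreover have "norm (pol n p z) \<le> 2" if z: "norm z = 1" for z
  proof -
    have fejer: "norm (\<Sum>l<n. (\<phi> l * dual_coeff n g l) * z ^ l) \<le> 1" if "norm z = 1" for z g
    proof -
      have "(\<Sum>l<n. (\<phi> l * dual_coeff n g l) * z ^ l) = (\<Sum>l<n. of_nat (n - l) * dual_coeff n g l * z ^ l) / of_nat n"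
        by (simp add: \<phi>_def sum_divide_distrib)
      then show ?thesis
        using dual_polynomial_bound[OF that, of n g] False by (simp add: norm_divide)
    qed
    have "(\<Sum>l<n. \<gamma>2 (n - Suc l) * z ^ l) = (\<Sum>l<n. \<gamma>2 (n - Suc l) * (z ^ (n - 1) * cnj z ^ (n - Suc l)))"
    proof (intro sum.cong refl)
      fix l assume "l \<in> {..<n}"
      then have "z ^ (n - 1) = z ^ l * z ^ (n - Suc l)" by (simp flip: power_add)
      moreover have "z ^ (n - Suc l) * cnj z ^ (n - Suc l) = 1"
        using z complex_norm_square[of z] by (simp flip: power_mult_distrib)
      ultimately show "\<gamma>2 (n - Suc l) * z ^ l = \<gamma>2 (n - Suc l) * (z ^ (n - 1) * cnj z ^ (n - Suc l))"
        by (simp add: mult.assoc)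
    qed
    also have "\<dots> = z ^ (n - 1) * (\<Sum>l<n. \<gamma>2 l * cnj z ^ l)"
      by (subst sum.nat_diff_reindex) (simp add: sum_distrib_left mult.left_commute)
    finally have "norm (\<Sum>l<n. \<gamma>2 (n - Suc l) * z ^ l) \<le> 1"
      using fejer[of "cnj z"] z by (simp add: norm_mult norm_power \<gamma>2_def)
    moreover have "norm (\<Sum>l<n. \<gamma>1 l * z ^ l) \<le> 1"
      using fejer[OF z] by (simp add: \<gamma>1_def)
    moreover have "pol n p z = (\<Sum>l<n. \<gamma>1 l * z ^ l) + (\<Sum>l<n. \<gamma>2 (n - Suc l) * z ^ l)"
      by (simp add: pol_def p_def distrib_right sum.distrib)
    ultimately show ?thesis
      using norm_triangle_ineq[of "\<Sum>l<n. \<gamma>1 l * z ^ l" "\<Sum>l<n. \<gamma>2 (n - Suc l) * z ^ l"] 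
      by simp
  qed
  ultimately show ?thesis by blast
qed (auto simp: pol_def)

theorem coefficient_majorant_polynomial:
  fixes y :: "nat \<Rightarrow> complex"
  assumes y: "(\<Sum>l<n. (norm (y l))\<^sup>2) \<le> B\<^sup>2" and "B \<ge> 0"
  shows "\<exists>p. (\<forall>l<n. norm (y l) \<le> norm (p l)) \<and> (\<forall>z. norm z = 1 \<longrightarrow> norm (pol n p z) \<le> 1728 * B)"
proof (cases "B = 0")
  case True
  then have "\<forall>l\<in>{..<n}. (norm (y l))\<^sup>2 = 0"
    using y by (subst sum_nonneg_eq_0_iff[symmetric]) (auto intro!: antisym sum_nonneg)
  then show ?thesis using True by (intro exI[of _ "\<lambda>_. 0"]) (auto simp: pol_def)
next
  case False
  with \<open>B \<ge> 0\<close> have "B > 0" by simp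
  have "(\<Sum>l<n. (norm (y l / B))\<^sup>2) = (\<Sum>l<n. (norm (y l))\<^sup>2) / B\<^sup>2"
    by (simp add: norm_divide power_divide sum_divide_distrib)
  also have "\<dots> \<le> 1" using y \<open>B > 0\<close> by simp
  finally have "(\<Sum>l<n. (norm (y l / B))\<^sup>2) \<le> 1" .
  from coefficient_majorant_polynomial_unit[OF this] obtain p where p: "\<And>l. l < n \<Longrightarrow> norm (y l / B) \<le> 864 * norm (p l)" 
      "\<And>z. norm z = 1 \<Longrightarrow> norm (pol n p z) \<le> 2"
    by blast
  have "pol n (\<lambda>l. of_real (864 * B) * p l) z = of_real (864 * B) * pol n p z" for z
    by (simp add: pol_def sum_distrib_left mult.assoc)
  then have "norm (pol n (\<lambda>l. of_real (864 * B) * p l) z) \<le> 1728 * B" if "norm z = 1" for z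
    using p(2)[OF that] \<open>B > 0\<close> by (simp add: norm_mult)
  moreover have "norm (y l) \<le> norm (of_real (864 * B) * p l)" if "l < n" for l
    using p(1)[OF that] \<open>B > 0\<close> by (simp add: norm_mult norm_divide field_simps)
  ultimately show ?thesis by (intro exI[of _ "\<lambda>l. of_real (864 * B) * p l"]) auto
qed

section \<open>Weight functions, entire series and the Bessel inequality\<close>

lemma LC_D:
  assumes "M \<in> LC"
  shows LC_pos: "M p > 0" and LC_0: "M 0 = 1"
    and LC_root: "filterlim (\<lambda>p. root p (M p)) at_top sequentially"
  using assms by (auto simp: LC_def)

lemma mu_Suc: "mu M (Suc p) = M (Suc p) / M p"
  by (simp add: mu_def)

lemma mu_pos: "M \<in> LC \<Longrightarrow> mu M p > 0"
  by (simp add: mu_def LC_pos)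

lemma mu_Suc_mono:
  assumes "M \<in> LC" "p \<le> q"
  shows "mu M (Suc p) \<le> mu M (Suc q)"
  using assms(2)
proof (induction q rule: dec_induct)
  case (step q)
  have "(M (Suc q))\<^sup>2 \<le> M q * M (Suc (Suc q))"
    using assms(1) by (auto simp: LC_def dest!: spec[of _ "Suc q"])
  then have "mu M (Suc q) \<le> mu M (Suc (Suc q))"
    using LC_pos[OF assms(1)] by (simp add: mu_Suc divide_simps power2_eq_square mult_ac)
  with step show ?case by simp
qed simp

text \<open>
  Log-convexity says that the quotients are nondecreasing; \<open>M q / M p\<close> is a product of \<open>q - p\<close> of them, the last being
  the largest.
\<close>

lemma LC_upper_ratio:
  assumes "M \<in> LC" "p \<le> q"
  shows "M q \<le> M p * mu M q ^ (q - p)"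
  using assms(2)
proof (induction q rule: dec_induct)
  case (step q)
  have "M (Suc q) = mu M (Suc q) * M q"
    using LC_pos[OF assms(1), of q] by (simp add: mu_Suc)
  also have "M q \<le> M p * mu M (Suc q) ^ (q - p)"
  proof (cases "q = p")
    case False
    with step have "mu M q \<le> mu M (Suc q)"
      using mu_Suc_mono[OF assms(1), of "q - 1" q] by simp
    then have "mu M q ^ (q - p) \<le> mu M (Suc q) ^ (q - p)"
      using mu_pos[OF assms(1)] by (intro power_mono) (auto simp: less_imp_le)
    then have "M p * mu M q ^ (q - p) \<le> M p * mu M (Suc q) ^ (q - p)"
      using LC_pos[OF assms(1)] by (intro mult_left_mono) (auto simp: less_imp_le)
    with step show ?thesis by linarith
  qed simp
  finally show ?case
    using step mu_pos[OF assms(1), of "Suc q"] by (simp add: Suc_diff_le mult_ac)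
qed simp

lemma LC_lower_ratio:
  assumes "M \<in> LC" "p \<le> q"
  shows "M p * mu M (Suc p) ^ (q - p) \<le> M q"
  using assms(2)
proof (induction q rule: dec_induct)
  case (step q)
  have "M p * mu M (Suc p) ^ (Suc q - p) = M p * mu M (Suc p) ^ (q - p) * mu M (Suc p)"
    using step by (simp add: Suc_diff_le)
  also have "\<dots> \<le> M q * mu M (Suc q)"
    using step mu_Suc_mono[OF assms(1), of p q] mu_pos[OF assms(1)] LC_pos[OF assms(1)]
    by (intro mult_mono) (auto simp: less_imp_le)
  also have "\<dots> = M (Suc q)"
    using LC_pos[OF assms(1), of q] by (simp add: mu_Suc)
  finally show ?case .
qed simp

lemma prod_mu:
  assumes "M \<in> LC" "k \<le> l"
  shows "(\<Prod>i=k+1..l. mu M i) = M l / M k"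
  using assms(2)
proof (induction l rule: dec_induct)
  case base
  then show ?case using LC_pos[OF assms(1), of k] by simp
next
  case (step l)
  then show ?case using LC_pos[OF assms(1), of l] by (simp add: mu_Suc)
qed

text \<open>
  At \<open>t = mu M (n + 1)\<close> the function \<open>p \<mapsto> t ^ p / M p\<close> is nondecreasing up to \<open>n\<close>, where the quotients
  are at most \<open>t\<close>, and nonincreasing afterwards, where they are at least \<open>t\<close>.
\<close>

lemma peak_at_mu:
  assumes "M \<in> LC"
  shows "mu M (Suc n) ^ p / M p \<le> mu M (Suc n) ^ n / M n"
proof -
  define t where "t = mu M (Suc n)"
  have t: "t > 0" using mu_pos[OF assms] by (simp add: t_def)
  have "t ^ p * M n \<le> t ^ n * M p"
  proof (cases "p \<le> n")
    case True
    have "M n \<le> M p * mu M n ^ (n - p)" by (rule LC_upper_ratio[OF assms True])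
    also have "\<dots> \<le> M p * t ^ (n - p)"
    proof (cases "n = p")
      case False
      then have "mu M n \<le> t" 
        using mu_Suc_mono[OF assms, of "n - 1" n] True by (simp add: t_def)
      then show ?thesis
        using mu_pos[OF assms] LC_pos[OF assms]
        by (intro mult_left_mono power_mono) (auto simp: less_imp_le)
    qed simp
    finally have "t ^ p * M n \<le> t ^ p * (M p * t ^ (n - p))" using t by simp
    also have "\<dots> = t ^ n * M p" using True by (simp flip: power_add)
    finally show ?thesis .
  next
    case False
    then have "M n * t ^ (p - n) \<le> M p" unfolding t_def by (intro LC_lower_ratio assms) simp
    then have "t ^ n * (M n * t ^ (p - n)) \<le> t ^ n * M p" using t by simp
    moreover have "t ^ n * (M n * t ^ (p - n)) = t ^ p * M n" using False by (simp flip: power_add)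
    ultimately show ?thesis by simp
  qed
  then show ?thesis
    unfolding t_def[symmetric] using LC_pos[OF assms] by (simp add: divide_simps mult.commute)
qed

lemma omega_bdd_above:
  assumes "M \<in> LC" "t > 0"
  shows "bdd_above (range (\<lambda>p. ln (t ^ p / M p)))"
proof -
  have "eventually (\<lambda>p. root p (M p) \<ge> t) sequentially"
    using LC_root[OF assms(1)] by (simp add: filterlim_at_top)
  then obtain N where N: "\<And>p. p \<ge> N \<Longrightarrow> root p (M p) \<ge> t" by (auto simp: eventually_sequentially)
  have "ln (t ^ p / M p) \<le> 0" if "p \<ge> Suc N" for p
  proof -
    have "t ^ p \<le> root p (M p) ^ p" using N[of p] that assms(2) by (intro power_mono) auto
    also have "\<dots> = M p" using that LC_pos[OF assms(1), of p] by (intro real_root_pow_pos2) auto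
    finally show ?thesis using LC_pos[OF assms(1), of p] assms(2) by (simp add: ln_le_zero_iff)
  qed
  note tail = this
  define m where "m = Max (insert 0 ((\<lambda>p. ln (t ^ p / M p)) ` {..N}))"
  have "0 \<le> m" unfolding m_def by (intro Max_ge) auto
  moreover have "ln (t ^ p / M p) \<le> m" if "p \<le> N" for p
    using that unfolding m_def by (intro Max_ge) auto
  ultimately have "ln (t ^ p / M p) \<le> m" for p
    using tail[of p] by (cases "p \<le> N") auto
  then show ?thesis by (intro bdd_aboveI) auto
qed

lemma weight_pos: "weight M c r > 0"
  by (simp add: weight_def)

lemma weight_mult_power_le:
  assumes "M \<in> LC" "c > 0" "r > 0"
  shows "weight M c r * (c * r) ^ p / M p \<le> 1"
proof -
  have t: "c * r > 0" using assms by simp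
  have pos: "(c * r) ^ p / M p > 0" using t LC_pos[OF assms(1)] by simp
  have "ln ((c * r) ^ p / M p) \<le> omega M (c * r)"
    unfolding omega_def using t by (simp add: cSUP_upper[OF _ omega_bdd_above[OF assms(1) t]])
  then have "exp (ln ((c * r) ^ p / M p)) \<le> exp (omega M (c * r))" by simp
  then have "(c * r) ^ p / M p \<le> exp (omega M (c * r))"
    using pos by simp
  then have "weight M c r * ((c * r) ^ p / M p) \<le> weight M c r * exp (omega M (c * r))"
    using weight_pos[of M c r] by (intro mult_left_mono) auto
  also have "\<dots> = 1" by (simp add: weight_def flip: exp_add)
  finally show ?thesis by simp
qed

lemma weight_radius:
  assumes "M \<in> LC" "c > 0"
  shows "weight M c (radius M c n) = M n / mu M (Suc n) ^ n"
proof -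
  define t where "t = mu M (Suc n)"
  have t: "t > 0" using mu_pos[OF assms(1)] by (simp add: t_def)
  have ct: "c * radius M c n = t" using assms by (simp add: radius_def t_def)
  have "(SUP p. ln (t ^ p / M p)) = ln (t ^ n / M n)"
  proof (rule antisym)
    show "(SUP p. ln (t ^ p / M p)) \<le> ln (t ^ n / M n)"
      using t LC_pos[OF assms(1)] peak_at_mu[OF assms(1)]
      by (intro cSUP_least ln_mono) (auto simp: t_def)
  qed (intro cSUP_upper omega_bdd_above assms t, simp)
  then have "weight M c (radius M c n) = exp (- ln (t ^ n / M n))"
    using t by (simp add: weight_def omega_def ct)
  also have "\<dots> = M n / t ^ n"
    using t LC_pos[OF assms(1), of n] by (simp add: exp_minus)
  finally show ?thesis by (simp add: t_def)
qed

lemma weight_radius':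
  assumes "M \<in> LC" "c > 0"
  shows "weight M c (radius M c n) = M (n + 1) / mu M (n + 1) ^ (n + 1)"
proof -
  have "M (n + 1) = mu M (n + 1) * M n"
    using LC_pos[OF assms(1), of n] by (simp add: mu_Suc)
  then show ?thesis
    using mu_pos[OF assms(1), of "n + 1"] by (simp add: weight_radius[OF assms])
qed

lemma summable_LC:
  fixes f :: "nat \<Rightarrow> complex"
  assumes "M \<in> LC" "\<And>l. norm (f l) \<le> C * c ^ l / M l" "c > 0"
  shows "summable (\<lambda>l. f l * z ^ l)"
proof -
  define t where "t = 2 * c * norm z + 1"
  have t: "t > 0" using assms(3) by (simp add: t_def add_nonneg_pos)
  have C: "C \<ge> 0" using order_trans[OF norm_ge_zero assms(2)[of 0]] LC_0[OF assms(1)] by simp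
  have "eventually (\<lambda>l. root l (M l) \<ge> t \<and> l > 0) sequentially"
    using LC_root[OF assms(1)] by (intro eventually_conj) (auto simp: filterlim_at_top eventually_gt_at_top)
  then have "eventually (\<lambda>l. norm (f l * z ^ l) \<le> C * (1/2) ^ l) sequentially"
  proof eventually_elim
    case (elim l)
    then have "t ^ l \<le> root l (M l) ^ l" using t by (intro power_mono) auto
    also have "\<dots> = M l" using elim LC_pos[OF assms(1), of l] by (intro real_root_pow_pos2) auto
    finally have M: "t ^ l \<le> M l" .
    have "(2 * c * norm z) ^ l \<le> t ^ l"
      using assms(3) by (intro power_mono) (auto simp: t_def)
    with M have "(c * norm z) ^ l * 2 ^ l \<le> M l" by (simp add: power_mult_distrib mult_ac)
    then have "(c * norm z) ^ l / M l \<le> (1/2) ^ l"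
      using LC_pos[OF assms(1), of l] by (simp add: divide_simps)
    then have "C * ((c * norm z) ^ l / M l) \<le> C * (1/2) ^ l" using C by (rule mult_left_mono)
    moreover have "norm (f l * z ^ l) \<le> C * c ^ l / M l * norm z ^ l"
      unfolding norm_mult norm_power using assms(2) by (intro mult_right_mono) auto
    ultimately show ?case by (simp add: power_mult_distrib)
  qed
  moreover have "summable (\<lambda>l. C * (1/2) ^ l :: real)" by (intro summable_mult summable_geometric) simp
  ultimately show ?thesis by (rule summable_comparison_test_ev)
qed

lemma entire_of_coefficients:
  assumes "\<And>z. summable (\<lambda>l. f l * z ^ l)"
  shows "(\<lambda>z. \<Sum>l. f l * z ^ l) holomorphic_on UNIV"
    and "taylor_coeffs (\<lambda>z. \<Sum>l. f l * z ^ l) = f"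
proof -
  have R: "fps_conv_radius (Abs_fps f) = \<infinity>"
    unfolding fps_conv_radius_def using assms by (simp add: conv_radius_inftyI'')
  have eq: "(\<lambda>z. \<Sum>l. f l * z ^ l) = eval_fps (Abs_fps f)"
    by (simp add: fun_eq_iff eval_fps_def)
  show "(\<lambda>z. \<Sum>l. f l * z ^ l) holomorphic_on UNIV"
    unfolding eq by (rule holomorphic_on_eval_fps) (simp add: R)
  show "taylor_coeffs (\<lambda>z. \<Sum>l. f l * z ^ l) = f"
  proof
    fix j
    show "taylor_coeffs (\<lambda>z. \<Sum>l. f l * z ^ l) j = f j"
      using fps_nth_conv_deriv[of "Abs_fps f" j]
      by (simp add: eq taylor_coeffs_def fps_expansion_def R)
  qed
qed

text \<open>
  Expand the nonnegative mean of \<open>(norm (h - P))\<^sup>2\<close>, where \<open>P\<close> is the partial Fourier sum.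
\<close>

lemma bessel_circle:
  assumes "continuous_on (sphere 0 1) h" "\<And>z. norm z = 1 \<Longrightarrow> norm (h z) \<le> B"
  shows "(\<Sum>l<N. (norm (circle_mean (\<lambda>z. h z * cnj z ^ l)))\<^sup>2) \<le> B\<^sup>2"
proof -
  define c where "c l = circle_mean (\<lambda>z. h z * cnj z ^ l)" for l
  define P where "P = pol N c"
  have P: "continuous_on A P" for A unfolding P_def by (intro continuous_intros)
  have hP: "continuous_on (sphere 0 1) (\<lambda>z. h z * cnj (P z))" by (intro continuous_intros P assms(1))
  have "circle_mean (\<lambda>z. h z * cnj (P z)) = circle_mean (\<lambda>z. \<Sum>l<N. cnj (c l) * (h z * cnj z ^ l))"
    by (simp add: P_def pol_def sum_distrib_left mult.left_commute)
  also have "\<dots> = (\<Sum>l<N. cnj (c l) * circle_mean (\<lambda>z. h z * cnj z ^ l))"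
    by (subst circle_mean_sum) (auto intro!: continuous_intros assms(1) sum.cong circle_mean_mult_left)
  also have "\<dots> = (\<Sum>l<N. complex_of_real ((norm (c l))\<^sup>2))"
    by (intro sum.cong refl) (simp only: complex_norm_square c_def mult.commute)
  finally have mean: "circle_mean (\<lambda>z. h z * cnj (P z)) = (\<Sum>l<N. complex_of_real ((norm (c l))\<^sup>2))" .
  have "circle_mean (\<lambda>z. 2 * Re (h z * cnj (P z))) \<le> circle_mean (\<lambda>z. B\<^sup>2 + (norm (P z))\<^sup>2)"
  proof (intro circle_mean_mono continuous_intros P assms(1))
    fix z :: complex assume "norm z = 1"
    then have "(norm (h z))\<^sup>2 \<le> B\<^sup>2" using assms(2) by (intro power_mono) auto
    moreover have "0 \<le> (norm (h z - P z))\<^sup>2" by simp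
    moreover have "(norm (h z - P z))\<^sup>2 = (norm (h z))\<^sup>2 - 2 * Re (h z * cnj (P z)) + (norm (P z))\<^sup>2"
      unfolding cmod_power2 by (simp add: power2_eq_square algebra_simps)
    ultimately show "2 * Re (h z * cnj (P z)) \<le> B\<^sup>2 + (norm (P z))\<^sup>2" by linarith
  qed
  moreover have "circle_mean (\<lambda>z. 2 * Re (h z * cnj (P z))) = 2 * Re (circle_mean (\<lambda>z. h z * cnj (P z)))"
    using circle_mean_mult_left[OF continuous_on_Re[OF hP], of 2] circle_mean_Re[OF hP] by simp
  moreover have "circle_mean (\<lambda>z. B\<^sup>2 + (norm (P z))\<^sup>2) = B\<^sup>2 + (\<Sum>l<N. (norm (c l))\<^sup>2)"
    by (subst circle_mean_add) 
      (auto intro!: continuous_intros P simp: P_def circle_mean_norm_pol_squared)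
  ultimately show ?thesis unfolding mean by (simp add: c_def[symmetric])
qed

lemma taylor_coeffs_square_sum_le:
  assumes "f holomorphic_on UNIV" "r > 0" "\<And>z. norm z = r \<Longrightarrow> norm (f z) \<le> B" "finite L"
  shows "(\<Sum>l\<in>L. (norm (taylor_coeffs f l))\<^sup>2 * r ^ (2 * l)) \<le> B\<^sup>2"
proof -
  have cont: "continuous_on A f" for A
    by (intro holomorphic_on_imp_continuous_on holomorphic_on_subset[OF assms(1)]) simp
  have hol: "f holomorphic_on ball 0 r" by (rule holomorphic_on_subset[OF assms(1)]) simp
  define h where "h z = f (r * z)" for z :: complex
  have h_cont: "continuous_on (sphere 0 1) h"
    unfolding h_def by (rule continuous_on_compose2[OF cont[of UNIV]]) (auto intro!: continuous_intros)
  have coeff: "circle_mean (\<lambda>z. h z * cnj z ^ l) = taylor_coeffs f l * r ^ l" for l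
    using circle_mean_Cauchy[OF cont hol assms(2), of l] 
    by (simp add: h_def taylor_coeffs_def fps_expansion_def)
  obtain N where N: "L \<subseteq> {..<N}" using assms(4) finite_nat_iff_bounded by blast
  have "(\<Sum>l\<in>L. (norm (taylor_coeffs f l))\<^sup>2 * r ^ (2 * l)) \<le> (\<Sum>l<N. (norm (taylor_coeffs f l))\<^sup>2 * r ^ (2 * l))"
    using N assms(2) by (intro sum_mono2) auto
  also have "\<dots> = (\<Sum>l<N. (norm (circle_mean (\<lambda>z. h z * cnj z ^ l)))\<^sup>2)"
    using assms(2) by (simp add: coeff norm_mult norm_power power_mult_distrib power_even_eq)
  also have "\<dots> \<le> B\<^sup>2"
    using assms(2,3) by (intro bessel_circle h_cont) (auto simp: h_def norm_mult)
  finally show ?thesis .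
qed

section \<open>Gluing the blocks\<close>

lemma norm_pol_le_inside:
  assumes "\<And>z. norm z = 1 \<Longrightarrow> norm (pol n p z) \<le> C" "norm z \<le> 1"
  shows "norm (pol n p z) \<le> C"
proof (rule maximum_modulus_frontier[of "pol n p" "cball 0 1"])
  show "pol n p holomorphic_on interior (cball 0 1)"
    unfolding pol_def[abs_def] by (intro holomorphic_intros)
  show "continuous_on (closure (cball 0 1)) (pol n p)"
    unfolding pol_def[abs_def] by (intro continuous_intros)
qed (use assms in auto)

text \<open>
  The maximum principle applied to the polynomial with reversed coefficients.
\<close>

lemma norm_pol_le_outside:
  assumes "\<And>z. norm z = 1 \<Longrightarrow> norm (pol n p z) \<le> C" "norm z \<ge> 1"
  shows "norm (pol n p z) \<le> C * norm z ^ (n - 1)"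
proof (cases "n = 0")
  case True
  have "0 \<le> C" using order_trans[OF norm_ge_zero assms(1)[of 1]] by simp
  with True show ?thesis by (simp add: pol_def)
next
  case False
  define q where "q l = p (n - Suc l)" for l
  have reversed: "pol n p z = z ^ (n - 1) * pol n q (1 / z)" if "z \<noteq> 0" for z
  proof -
    have "pol n p z = (\<Sum>l<n. p (n - Suc l) * z ^ (n - Suc l))"
      unfolding pol_def by (rule sum.nat_diff_reindex[symmetric])
    also have "\<dots> = z ^ (n - 1) * pol n q (1 / z)"
      unfolding pol_def sum_distrib_left
    proof (rule sum.cong[OF refl])
      fix l assume "l \<in> {..<n}"
      then have "z ^ (n - 1) = z ^ (n - Suc l) * z ^ l" by (simp flip: power_add)
      then show "p (n - Suc l) * z ^ (n - Suc l) = z ^ (n - 1) * (q l * (1 / z) ^ l)"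
        using that by (simp add: q_def power_divide)
    qed
    finally show ?thesis .
  qed
  have "norm (pol n q w) \<le> C" if "norm w = 1" for w
  proof -
    have "w \<noteq> 0" "norm (1 / w) = 1" using that by (auto simp: norm_divide)
    then show ?thesis
      using assms(1)[of "1 / w"] reversed[of "1 / w"] that by (simp add: norm_mult norm_power norm_divide)
  qed
  moreover have "norm (1 / z) \<le> 1" using assms(2) by (simp add: norm_divide divide_simps)
  ultimately have "norm (pol n q (1 / z)) \<le> C" by (rule norm_pol_le_inside)
  then have "norm z ^ (n - 1) * norm (pol n q (1 / z)) \<le> norm z ^ (n - 1) * C"
    by (rule mult_left_mono) simp
  moreover have "z \<noteq> 0" using assms(2) by auto
  ultimately show ?thesis
    by (simp add: reversed norm_mult norm_power mult.commute)
qed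

lemma norm_coeff_le:
  assumes "\<And>z. norm z = 1 \<Longrightarrow> norm (pol n p z) \<le> C" "l < n"
  shows "norm (p l) \<le> C"
proof -
  have "norm (circle_mean (\<lambda>z. pol n p z * cnj z ^ l)) \<le> circle_mean (\<lambda>z. C)"
    using assms(1) by (intro norm_circle_mean_le continuous_intros) (auto simp: norm_mult norm_power)
  then show ?thesis using circle_mean_pol_coeff[OF assms(2), of p] by simp
qed

text \<open>
  The terms at least halve away from the crossing point of \<open>\<tau>\<close> and \<open>t\<close> on either side. To avoid naming that point, both
  halves of the sum are bounded by invariants that hold for all \<open>J\<close>.
\<close>

lemma two_sided_geometric_sum:
  fixes e \<tau> :: "nat \<Rightarrow> real"
  assumes e: "\<And>j. 0 \<le> e j" "\<And>j. e j \<le> 1" and "mono \<tau>" and "K \<ge> 0"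
    and rising: "\<And>j. t \<le> \<tau> j \<Longrightarrow> 2 * e (Suc j) \<le> e j"
    and falling: "\<And>j. \<tau> (Suc j) \<le> t \<Longrightarrow> 2 * e j \<le> e (Suc j)"
  shows "(\<Sum>j<J. if t \<le> \<tau> j then e j else K * e (Suc j)) \<le> 2 + 3 * K"
proof -
  define U where "U J = (\<Sum>j<J. if t \<le> \<tau> j then e j else 0)" for J
  define D where "D J = (\<Sum>j<J. if t \<le> \<tau> j then 0 else e (Suc j))" for J
  have U_Suc: "U (Suc J) = U J + (if t \<le> \<tau> J then e J else 0)" for J
    by (simp add: U_def)
  have D_Suc: "D (Suc J) = D J + (if t \<le> \<tau> J then 0 else e (Suc J))" for J
    by (simp add: D_def)
  have "U J + 2 * e J \<le> 2"
  proof (induction J)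
    case 0
    then show ?case using e(2)[of 0] by (simp add: U_def)
  next
    case (Suc J)
    show ?case
    proof (cases "t \<le> \<tau> J")
      case True
      then show ?thesis using Suc rising[OF True] by (simp add: U_Suc)
    next
      case False
      have "\<tau> j < t" if "j < Suc J" for j
        using monoD[OF \<open>mono \<tau>\<close>, of j J] that False by simp
      then have "U (Suc J) = 0" unfolding U_def by (intro sum.neutral) (auto simp: not_le[symmetric])
      then show ?thesis using e(2)[of "Suc J"] by simp
    qed
  qed
  then have U: "U J \<le> 2" using e(1)[of J] by linarith
  have "D J \<le> 3 \<and> (\<forall>i. J = Suc i \<and> \<tau> i < t \<longrightarrow> D J \<le> 2 * e i + e J)"
  proof (induction J)
    case (Suc J)
    show ?case
    proof (cases "t \<le> \<tau> J")
      case False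
      have "D (Suc J) \<le> 2 * e J + e (Suc J)"
      proof (cases J)
        case 0
        then show ?thesis using e(1)[of 0] False by (simp add: D_def)
      next
        case (Suc i)
        have "\<tau> i < t" using monoD[OF \<open>mono \<tau>\<close>, of i J] False Suc by simp
        then have "D J \<le> 2 * e i + e J" using Suc.IH Suc by blast
        moreover have "2 * e i \<le> e J" using falling[of i] False Suc by simp
        ultimately show ?thesis using False by (simp add: D_Suc)
      qed
      then show ?thesis using e(2)[of J] e(2)[of "Suc J"] by auto
    qed (use Suc in \<open>auto simp: D_Suc\<close>)
  qed (simp add: D_def)
  then have D: "K * D J \<le> K * 3" using \<open>K \<ge> 0\<close> by (intro mult_left_mono) auto
  have "(\<Sum>j<J. if t \<le> \<tau> j then e j else K * e (Suc j)) = U J + K * D J"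
    unfolding U_def D_def sum_distrib_left sum.distrib[symmetric] by (intro sum.cong) auto
  with U D show ?thesis by linarith
qed

text \<open>
  The hypotheses on \<open>M\<close> are the bounds on the quotients \<open>A\<close> and \<open>B\<close> between consecutive indices, cleared of
  denominators, and \<open>M (\<alpha> j) / \<tau> j ^ \<alpha> j\<close> is the weight at the radius \<open>\<tau> j / c\<close>. On each block the normalised
  coefficients are majorised by a polynomial \<open>p j\<close>; below the first block the given coefficients are
  kept. The upper bound by \<open>K\<close> serves twice: it compares the coefficients with \<open>c ^ l / M l\<close>, so that the series
  is entire, and it bounds a block beyond its radius by the term of the next one.
\<close>

theorem block_majorant_exists:
  fixes \<alpha> :: "nat \<Rightarrow> nat" and x :: "nat \<Rightarrow> complex"
  assumes LC: "M \<in> LC" and c: "c > 0" and \<alpha>: "strict_mono \<alpha>"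
  defines "\<tau> \<equiv> \<lambda>j. mu M (Suc (\<alpha> j))"
  assumes A: "\<And>j. 2 * M (\<alpha> (Suc j)) \<le> M (\<alpha> j) * \<tau> (Suc j) ^ (\<alpha> (Suc j) - \<alpha> j)"
    and B1: "\<And>j. 2 * (M (\<alpha> j) * \<tau> j ^ (\<alpha> (Suc j) - \<alpha> j)) \<le> M (\<alpha> (Suc j))"
    and B2: "\<And>j. M (\<alpha> (Suc j)) \<le> K * (M (\<alpha> j) * \<tau> j ^ (\<alpha> (Suc j) - \<alpha> j))"
    and x: "\<And>j. M (\<alpha> j) / \<tau> j ^ \<alpha> j * 
              sqrt (\<Sum>l\<in>{\<alpha> j<..\<alpha> (Suc j)}. (norm (x l))\<^sup>2 * (\<tau> j / c) ^ (2 * l)) \<le> B"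
  shows "\<exists>f\<in>H_inf (weight M c). \<forall>l. norm (x l) \<le> norm (taylor_coeffs f l)"
proof -
  note Mpos = LC_pos[OF LC]
  have \<tau>: "\<tau> j > 0" for j by (simp add: \<tau>_def mu_pos LC)
  have "mono \<tau>" 
    unfolding \<tau>_def by (intro monoI mu_Suc_mono LC) (simp add: \<alpha> strict_mono_less_eq)
  have \<alpha>_Suc: "\<alpha> j < \<alpha> (Suc j)" for j by (simp add: \<alpha> strict_mono_less)
  define N where "N j = \<alpha> (Suc j) - \<alpha> j" for j
  define V where "V j = M (\<alpha> j) / \<tau> j ^ \<alpha> j" for j
  define \<rho> where "\<rho> j = \<tau> j / c" for j
  have V: "V j > 0" and \<rho>: "\<rho> j > 0" for j using Mpos \<tau> c by (simp_all add: V_def \<rho>_def)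
  have "0 \<le> M (\<alpha> 0) / \<tau> 0 ^ \<alpha> 0 * 
              sqrt (\<Sum>l\<in>{\<alpha> 0<..\<alpha> (Suc 0)}. (norm (x l))\<^sup>2 * (\<tau> 0 / c) ^ (2 * l))"
    using Mpos[of "\<alpha> 0"] \<tau>[of 0] c by (intro mult_nonneg_nonneg) (auto intro!: sum_nonneg simp: less_imp_le)
  with x[of 0] have B: "B \<ge> 0" by linarith
  have K: "K \<ge> 1"
  proof -
    define Z where "Z = M (\<alpha> 0) * \<tau> 0 ^ (\<alpha> (Suc 0) - \<alpha> 0)"
    have "Z > 0" unfolding Z_def using Mpos \<tau> by simp
    moreover have "1 * Z \<le> K * Z" using B1[of 0] B2[of 0] \<open>Z > 0\<close> unfolding Z_def by linarith
    ultimately show ?thesis by (simp only: mult_le_cancel_right_pos)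
  qed
  define C where "C = 1728 * B"
  have C: "C \<ge> 0" using B by (simp add: C_def)
  have "\<exists>p. (\<forall>i<N j. norm (of_real (V j * \<rho> j ^ (\<alpha> j + 1 + i)) * x (\<alpha> j + 1 + i)) \<le> norm (p i)) 
      \<and> (\<forall>z. norm z = 1 \<longrightarrow> norm (pol (N j) p z) \<le> C)" for j
    unfolding C_def
  proof (rule coefficient_majorant_polynomial[OF _ B])
    have square: "(norm (of_real (V j * \<rho> j ^ m) * y))\<^sup>2 = (V j)\<^sup>2 * ((norm y)\<^sup>2 * \<rho> j ^ (2 * m))"
      for m and y :: complex
      using V[of j] \<rho>[of j] by (simp add: norm_mult norm_power power_mult_distrib power_even_eq)
    have "(\<Sum>i<N j. (norm (of_real (V j * \<rho> j ^ (\<alpha> j + 1 + i)) * x (\<alpha> j + 1 + i)))\<^sup>2)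
        = (\<Sum>l\<in>{\<alpha> j<..\<alpha> (Suc j)}. (V j)\<^sup>2 * ((norm (x l))\<^sup>2 * (\<rho> j) ^ (2 * l)))"
      unfolding square
      by (intro sum.reindex_bij_witness[of _ "\<lambda>l. l - \<alpha> j - 1" "\<lambda>i. \<alpha> j + 1 + i"]) (auto simp: N_def)
    also have "\<dots> = (V j * sqrt (\<Sum>l\<in>{\<alpha> j<..\<alpha> (Suc j)}. (norm (x l))\<^sup>2 * (\<rho> j) ^ (2 * l)))\<^sup>2"
      using \<rho>[of j] by (simp add: power_mult_distrib sum_distrib_left sum_nonneg)
    also have "\<dots> \<le> B\<^sup>2"
      using x[of j] V[of j] \<rho>[of j] unfolding V_def[symmetric] \<rho>_def[symmetric]
      by (intro power_mono mult_nonneg_nonneg) (auto intro!: sum_nonneg simp: less_imp_le)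
    finally show "(\<Sum>i<N j. (norm (of_real (V j * \<rho> j ^ (\<alpha> j + 1 + i)) * x (\<alpha> j + 1 + i)))\<^sup>2) \<le> B\<^sup>2" .
  qed
  then obtain p where p: "\<And>j i. i < N j \<Longrightarrow> norm (of_real (V j * \<rho> j ^ (\<alpha> j + 1 + i)) * x (\<alpha> j + 1 + i)) \<le> norm (p j i)"
      and p_bound: "\<And>j z. norm z = 1 \<Longrightarrow> norm (pol (N j) (p j) z) \<le> C"
    by metis
  define idx where "idx l = (LEAST j. l \<le> \<alpha> (Suc j))" for l
  define f where "f l = (if l \<le> \<alpha> 0 then x l else 
      p (idx l) (l - \<alpha> (idx l) - 1) / of_real (V (idx l) * \<rho> (idx l) ^ l))" for l
  have idx: "idx l = j" if "l \<in> {\<alpha> j<..\<alpha> (Suc j)}" for l j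
    unfolding idx_def
  proof (rule Least_equality)
    fix i assume "l \<le> \<alpha> (Suc i)"
    then have "\<alpha> j < \<alpha> (Suc i)" using that by auto
    then show "j \<le> i" using \<alpha> by (simp add: strict_mono_less)
  qed (use that in auto)
  have block: "\<exists>j. l \<in> {\<alpha> j<..\<alpha> (Suc j)}" if "\<alpha> 0 < l" for l
  proof -
    have ex: "l \<le> \<alpha> (Suc l)" using strict_mono_imp_increasing[OF \<alpha>, of "Suc l"] by simp
    then have "l \<le> \<alpha> (Suc (idx l))" unfolding idx_def by (rule LeastI)
    moreover have "\<alpha> (idx l) < l"
    proof (cases "idx l")
      case (Suc i)
      then have "i < idx l" by simp
      then have "\<not> l \<le> \<alpha> (Suc i)" unfolding idx_def by (rule not_less_Least)
      then show ?thesis by (simp add: Suc)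
    qed (use that in simp)
    ultimately show ?thesis by auto
  qed
  have f_block: "f (\<alpha> j + 1 + i) = p j i / of_real (V j * \<rho> j ^ (\<alpha> j + 1 + i))" if "i < N j" for i j
  proof -
    have "\<alpha> 0 \<le> \<alpha> j" using \<alpha> by (simp add: strict_mono_less_eq)
    moreover have "idx (\<alpha> j + 1 + i) = j" using that by (intro idx) (auto simp: N_def)
    ultimately show ?thesis by (simp add: f_def)
  qed
  have f_ge: "norm (x l) \<le> norm (f l)" for l
  proof (cases "l \<le> \<alpha> 0")
    case False
    then obtain j where j: "l \<in> {\<alpha> j<..\<alpha> (Suc j)}" using block by force
    define i where "i = l - \<alpha> j - 1"
    have i: "i < N j" "l = \<alpha> j + 1 + i" using j by (auto simp: i_def N_def)
    define q where "q = V j * \<rho> j ^ l"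
    have q: "q > 0" using V \<rho> by (simp add: q_def)
    have "norm (of_real q * x l) \<le> norm (p j i)"
      using p[OF i(1)] unfolding i(2)[symmetric] q_def .
    moreover have "f l = p j i / of_real q"
      using f_block[OF i(1)] unfolding i(2)[symmetric] q_def .
    ultimately show ?thesis
      using q by (simp add: norm_mult norm_divide pos_le_divide_eq mult.commute)
  qed (simp add: f_def)
  have f_le: "norm (f l) \<le> (\<Sum>i\<le>\<alpha> 0. norm (x i) * M i / c ^ i) * c ^ l / M l" if "l \<le> \<alpha> 0" for l
  proof -
    have "norm (x l) * M l / c ^ l \<le> (\<Sum>i\<le>\<alpha> 0. norm (x i) * M i / c ^ i)"
      using that Mpos c by (intro member_le_sum) (auto simp: less_imp_le)
    then have "norm (x l) * M l / c ^ l * (c ^ l / M l) \<le> (\<Sum>i\<le>\<alpha> 0. norm (x i) * M i / c ^ i) * (c ^ l / M l)"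
      using Mpos c by (intro mult_right_mono) (auto simp: less_imp_le)
    then show ?thesis using that Mpos[of l] c by (simp add: f_def)
  qed
  define C' where "C' = (\<Sum>i\<le>\<alpha> 0. norm (x i) * M i / c ^ i) + C * K"
  have sum0: "(\<Sum>i\<le>\<alpha> 0. norm (x i) * M i / c ^ i) \<ge> 0"
    using Mpos c by (intro sum_nonneg) (auto simp: less_imp_le)
  have f_le': "norm (f l) \<le> C' * c ^ l / M l" for l
  proof (cases "l \<le> \<alpha> 0")
    case True
    have "(\<Sum>i\<le>\<alpha> 0. norm (x i) * M i / c ^ i) * (c ^ l / M l) \<le> C' * (c ^ l / M l)"
      using C K Mpos c by (intro mult_right_mono) (auto simp: C'_def less_imp_le)
    with f_le[OF True] show ?thesis by simp
  next
    case False
    then obtain j where j: "l \<in> {\<alpha> j<..\<alpha> (Suc j)}" using block by force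
    define i where "i = l - \<alpha> j - 1"
    have i: "i < N j" "l = \<alpha> j + 1 + i" using j by (auto simp: i_def N_def)
    have tl: "\<tau> j \<le> mu M (Suc l)" unfolding \<tau>_def using j by (intro mu_Suc_mono LC) auto
    have "M l * \<tau> j ^ (\<alpha> (Suc j) - l) \<le> M l * mu M (Suc l) ^ (\<alpha> (Suc j) - l)"
      using tl \<tau>[of j] Mpos[of l] by (intro mult_left_mono power_mono) (auto simp: less_imp_le)
    also have "\<dots> \<le> M (\<alpha> (Suc j))" using j by (intro LC_lower_ratio LC) auto
    also have "\<dots> \<le> K * (M (\<alpha> j) * \<tau> j ^ (\<alpha> (Suc j) - \<alpha> j))" by (rule B2)
    also have "\<alpha> (Suc j) - \<alpha> j = (l - \<alpha> j) + (\<alpha> (Suc j) - l)" using j by auto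
    finally have "M l * \<tau> j ^ (\<alpha> (Suc j) - l) \<le> (K * (M (\<alpha> j) * \<tau> j ^ (l - \<alpha> j))) * \<tau> j ^ (\<alpha> (Suc j) - l)"
      by (simp add: power_add mult_ac)
    then have Ml: "M l \<le> K * (M (\<alpha> j) * \<tau> j ^ (l - \<alpha> j))"
      using \<tau>[of j] by (simp only: mult_le_cancel_right_pos zero_less_power)
    have "V j * \<rho> j ^ l = M (\<alpha> j) * \<tau> j ^ (l - \<alpha> j) / c ^ l"
    proof -
      have "\<tau> j ^ l = \<tau> j ^ \<alpha> j * \<tau> j ^ (l - \<alpha> j)" using j by (simp flip: power_add)
      then show ?thesis using \<tau>[of j] by (simp add: V_def \<rho>_def power_divide)
    qed
    then have "M l / c ^ l \<le> K * (V j * \<rho> j ^ l)"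
      using Ml c by (simp add: divide_right_mono)
    then have 1: "1 / (V j * \<rho> j ^ l) \<le> K * c ^ l / M l"
      using V[of j] \<rho>[of j] Mpos[of l] c by (simp add: field_simps)
    have 2: "norm (f l) = norm (p j i) * (1 / (V j * \<rho> j ^ l))"
      using f_block[OF i(1)] V[of j] \<rho>[of j] unfolding i(2)[symmetric]
      by (simp add: norm_divide norm_mult norm_power)
    have "norm (p j i) \<le> C" using p_bound i(1) by (rule norm_coeff_le)
    then have "norm (f l) \<le> C * (K * c ^ l / M l)"
      unfolding 2 using V[of j] \<rho>[of j] C by (intro mult_mono 1) (auto simp: less_imp_le)
    also have "\<dots> \<le> (\<Sum>i\<le>\<alpha> 0. norm (x i) * M i / c ^ i) * (c ^ l / M l) + C * K * (c ^ l / M l)"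
    proof -
      have "0 \<le> (\<Sum>i\<le>\<alpha> 0. norm (x i) * M i / c ^ i) * (c ^ l / M l)"
        using sum0 Mpos[of l] c by (intro mult_nonneg_nonneg) (auto simp: less_imp_le)
      moreover have "C * (K * c ^ l / M l) = C * K * (c ^ l / M l)" by simp
      ultimately show ?thesis by linarith
    qed
    finally show ?thesis by (simp add: C'_def distrib_right add_divide_distrib)
  qed
  define F where "F z = (\<Sum>l. f l * z ^ l)" for z
  note summable = summable_LC[OF LC f_le' c]
  have F_hol: "F holomorphic_on UNIV" and F_coeffs: "taylor_coeffs F = f"
    unfolding F_def[abs_def] by (rule entire_of_coefficients[OF summable])+
  define D where "D = (\<Sum>l\<le>\<alpha> 0. norm (x l) * M l / c ^ l) + C * (2 + 3 * K)"
  have partial_sums: "(\<Sum>l\<le>\<alpha> J. f l * z ^ l) 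
      = (\<Sum>l\<le>\<alpha> 0. x l * z ^ l) + (\<Sum>j<J. \<Sum>i<N j. f (\<alpha> j + 1 + i) * z ^ (\<alpha> j + 1 + i))" for z J
  proof (induction J)
    case 0
    show ?case by (simp add: f_def)
  next
    case (Suc J)
    have "(\<Sum>l\<le>\<alpha> (Suc J). f l * z ^ l) 
        = (\<Sum>l\<le>\<alpha> J. f l * z ^ l) + (\<Sum>l\<in>{\<alpha> J<..\<alpha> (Suc J)}. f l * z ^ l)"
      using \<alpha>_Suc[of J] by (subst sum.union_disjoint[symmetric]) (auto intro!: sum.cong)
    also have "(\<Sum>l\<in>{\<alpha> J<..\<alpha> (Suc J)}. f l * z ^ l) = (\<Sum>i<N J. f (\<alpha> J + 1 + i) * z ^ (\<alpha> J + 1 + i))"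
      by (intro sum.reindex_bij_witness[of _ "\<lambda>i. \<alpha> J + 1 + i" "\<lambda>l. l - \<alpha> J - 1"]) (auto simp: N_def)
    finally show ?case using Suc by simp
  qed
  have bound: "norm (F z) * weight M c (norm z) \<le> D" if "z \<noteq> 0" for z
  proof -
    define r where "r = norm z"
    have r: "r > 0" using that by (simp add: r_def)
    define v where "v = weight M c r"
    have v: "v > 0" by (simp add: v_def weight_pos)
    define t where "t = c * r"
    have t: "t > 0" using r c by (simp add: t_def)
    define e where "e j = v * t ^ \<alpha> j / M (\<alpha> j)" for j
    have e: "0 < e j" "e j \<le> 1" for j
      using v t Mpos weight_mult_power_le[OF LC c r] by (simp_all add: e_def v_def t_def)
    have t_split: "t ^ \<alpha> (Suc j) = t ^ \<alpha> j * t ^ N j" for j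
      using \<alpha>_Suc[of j] by (simp add: N_def flip: power_add)
    \<comment> \<open>The bound on \<open>B\<close> gives decay for blocks beyond the radius, the bound on \<open>A\<close> for blocks before it.\<close>
    have rising: "2 * e (Suc j) \<le> e j" if "t \<le> \<tau> j" for j
    proof -
      have "2 * (M (\<alpha> j) * t ^ N j) \<le> 2 * (M (\<alpha> j) * \<tau> j ^ N j)"
        using t that Mpos[of "\<alpha> j"] by (intro mult_left_mono power_mono) (auto simp: less_imp_le)
      with B1[of j] have "2 * (M (\<alpha> j) * t ^ N j) \<le> M (\<alpha> (Suc j))" by (simp add: N_def)
      then have "(v * t ^ \<alpha> j) * (2 * (M (\<alpha> j) * t ^ N j)) \<le> (v * t ^ \<alpha> j) * M (\<alpha> (Suc j))"
        using v t by (intro mult_left_mono) auto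
      then show ?thesis
        using Mpos[of "\<alpha> j"] Mpos[of "\<alpha> (Suc j)"] by (simp add: e_def t_split divide_simps mult_ac)
    qed
    have falling: "2 * e j \<le> e (Suc j)" if "\<tau> (Suc j) \<le> t" for j
    proof -
      have "M (\<alpha> j) * \<tau> (Suc j) ^ N j \<le> M (\<alpha> j) * t ^ N j"
        using \<tau>[of "Suc j"] that Mpos[of "\<alpha> j"] by (intro mult_left_mono power_mono) (auto simp: less_imp_le)
      with A[of j] have "2 * M (\<alpha> (Suc j)) \<le> M (\<alpha> j) * t ^ N j" by (simp add: N_def)
      then have "(v * t ^ \<alpha> j) * (2 * M (\<alpha> (Suc j))) \<le> (v * t ^ \<alpha> j) * (M (\<alpha> j) * t ^ N j)"
        using v t by (intro mult_left_mono) auto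
      then show ?thesis
        using Mpos[of "\<alpha> j"] Mpos[of "\<alpha> (Suc j)"] by (simp add: e_def t_split divide_simps mult_ac)
    qed
    \<comment> \<open>Inside its radius a block is dominated by its lowest power, outside by its highest.\<close>
    have block_bound: "norm (\<Sum>i<N j. f (\<alpha> j + 1 + i) * z ^ (\<alpha> j + 1 + i)) * v
        \<le> C * (if t \<le> \<tau> j then e j else K * e (Suc j))" for j
    proof -
      define w where "w = z / of_real (\<rho> j)"
      have "norm w = r / \<rho> j"
        using \<rho>[of j] by (simp add: w_def norm_divide r_def)
      then have norm_w: "norm w = t / \<tau> j" using c by (simp add: \<rho>_def t_def mult.commute)
      have "(\<Sum>i<N j. f (\<alpha> j + 1 + i) * z ^ (\<alpha> j + 1 + i)) 
          = w ^ (\<alpha> j + 1) / of_real (V j) * pol (N j) (p j) w"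
        unfolding pol_def sum_distrib_left
      proof (rule sum.cong[OF refl])
        fix i assume "i \<in> {..<N j}"
        then have "f (\<alpha> j + 1 + i) = p j i / of_real (V j * \<rho> j ^ (\<alpha> j + 1 + i))" using f_block by simp
        moreover have "z ^ (\<alpha> j + 1 + i) = of_real (\<rho> j ^ (\<alpha> j + 1 + i)) * w ^ (\<alpha> j + 1 + i)"
          using \<rho>[of j] by (simp add: w_def power_divide del: power_Suc)
        ultimately show "f (\<alpha> j + 1 + i) * z ^ (\<alpha> j + 1 + i) = w ^ (\<alpha> j + 1) / of_real (V j) * (p j i * w ^ i)"
          using \<rho>[of j] power_add[of w "\<alpha> j + 1" i] by (simp del: power_Suc)
      qed
      then have norm_block: "norm (\<Sum>i<N j. f (\<alpha> j + 1 + i) * z ^ (\<alpha> j + 1 + i)) 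
          = (t / \<tau> j) ^ (\<alpha> j + 1) / V j * norm (pol (N j) (p j) w)"
        using V[of j] by (simp only: norm_mult norm_divide norm_power norm_w norm_of_real abs_of_pos)
      show ?thesis
      proof (cases "t \<le> \<tau> j")
        case True
        then have tt: "t / \<tau> j \<le> 1" "0 \<le> t / \<tau> j" using \<tau>[of j] t by simp_all
        have "norm w \<le> 1" unfolding norm_w by (rule tt(1))
        with p_bound have "norm (pol (N j) (p j) w) \<le> C" by (rule norm_pol_le_inside)
        moreover have "(t / \<tau> j) ^ (\<alpha> j + 1) \<le> (t / \<tau> j) ^ \<alpha> j"
          using tt by (intro power_decreasing) auto
        ultimately have "(t / \<tau> j) ^ (\<alpha> j + 1) / V j * norm (pol (N j) (p j) w) * v \<le> (t / \<tau> j) ^ \<alpha> j / V j * C * v"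
          using V[of j] tt v C by (intro mult_right_mono mult_mono divide_right_mono) auto
        also have "\<dots> = C * e j"
          using \<tau>[of j] Mpos[of "\<alpha> j"] by (simp add: V_def e_def power_divide)
        finally show ?thesis using True norm_block by simp
      next
        case False
        then have tt: "1 \<le> t / \<tau> j" using \<tau>[of j] t by simp
        have "1 \<le> norm w" unfolding norm_w by (rule tt)
        with p_bound have "norm (pol (N j) (p j) w) \<le> C * norm w ^ (N j - 1)" by (rule norm_pol_le_outside)
        then have "(t / \<tau> j) ^ (\<alpha> j + 1) / V j * norm (pol (N j) (p j) w) * v 
            \<le> (t / \<tau> j) ^ (\<alpha> j + 1) / V j * (C * norm w ^ (N j - 1)) * v"
          using V[of j] \<tau>[of j] t v by (intro mult_right_mono mult_left_mono) auto
        also have "\<dots> = C * v * ((t / \<tau> j) ^ (\<alpha> j + 1 + (N j - 1)) / V j)"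
          by (simp add: norm_w power_add)
        also have "\<alpha> j + 1 + (N j - 1) = \<alpha> (Suc j)" using \<alpha>_Suc[of j] by (simp add: N_def)
        also have "(t / \<tau> j) ^ \<alpha> (Suc j) / V j = t ^ \<alpha> (Suc j) / (M (\<alpha> j) * \<tau> j ^ N j)"
        proof -
          have "\<tau> j ^ \<alpha> (Suc j) = \<tau> j ^ \<alpha> j * \<tau> j ^ N j"
            using \<alpha>_Suc[of j] by (simp add: N_def flip: power_add)
          then show ?thesis using \<tau>[of j] by (simp add: V_def power_divide)
        qed
        also have "\<dots> \<le> t ^ \<alpha> (Suc j) * (K / M (\<alpha> (Suc j)))"
        proof -
          have "1 / (M (\<alpha> j) * \<tau> j ^ N j) \<le> K / M (\<alpha> (Suc j))"
            using B2[of j] Mpos[of "\<alpha> j"] Mpos[of "\<alpha> (Suc j)"] \<tau>[of j] 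
            by (simp add: N_def[symmetric] field_simps)
          then have "t ^ \<alpha> (Suc j) * (1 / (M (\<alpha> j) * \<tau> j ^ N j)) \<le> t ^ \<alpha> (Suc j) * (K / M (\<alpha> (Suc j)))"
            using t by (intro mult_left_mono) auto
          then show ?thesis by simp
        qed
        also have "C * v * (t ^ \<alpha> (Suc j) * (K / M (\<alpha> (Suc j)))) = C * (K * e (Suc j))"
          by (simp add: e_def)
        finally show ?thesis using False norm_block C v by (simp add: mult_left_mono)
      qed
    qed
    have "norm (\<Sum>l\<le>\<alpha> J. f l * z ^ l) * v \<le> D" for J
    proof -
      have "norm (\<Sum>l\<le>\<alpha> J. f l * z ^ l) * v 
          \<le> ((\<Sum>l\<le>\<alpha> 0. norm (x l * z ^ l)) + (\<Sum>j<J. norm (\<Sum>i<N j. f (\<alpha> j + 1 + i) * z ^ (\<alpha> j + 1 + i)))) * v"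
        unfolding partial_sums using v
        by (intro mult_right_mono order_trans[OF norm_triangle_ineq] add_mono norm_sum) auto
      also have "\<dots> = (\<Sum>l\<le>\<alpha> 0. norm (x l * z ^ l) * v) 
          + (\<Sum>j<J. norm (\<Sum>i<N j. f (\<alpha> j + 1 + i) * z ^ (\<alpha> j + 1 + i)) * v)"
        by (simp add: distrib_right sum_distrib_right)
      also have "\<dots> \<le> (\<Sum>l\<le>\<alpha> 0. norm (x l) * M l / c ^ l) + (\<Sum>j<J. C * (if t \<le> \<tau> j then e j else K * e (Suc j)))"
      proof (intro add_mono sum_mono block_bound)
        fix l
        have "v * (c * r) ^ l / M l \<le> 1" unfolding v_def by (rule weight_mult_power_le[OF LC c r])
        then have "r ^ l * v \<le> M l / c ^ l"
          using Mpos[of l] c by (simp add: field_simps power_mult_distrib)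
        then have "norm (x l) * (r ^ l * v) \<le> norm (x l) * (M l / c ^ l)" by (rule mult_left_mono) simp
        then show "norm (x l * z ^ l) * v \<le> norm (x l) * M l / c ^ l"
          by (simp add: norm_mult norm_power r_def[symmetric] mult.assoc)
      qed
      also have "(\<Sum>j<J. C * (if t \<le> \<tau> j then e j else K * e (Suc j))) \<le> C * (2 + 3 * K)"
        unfolding sum_distrib_left[symmetric] using e \<open>mono \<tau>\<close> K rising falling C
        by (intro mult_left_mono two_sided_geometric_sum) (auto simp: less_imp_le)
      finally show ?thesis by (simp add: D_def)
    qed
    moreover have "(\<lambda>J. norm (\<Sum>l\<le>\<alpha> J. f l * z ^ l) * v) \<longlonglongrightarrow> norm (F z) * v"
    proof -
      have "(\<lambda>n. \<Sum>l\<le>n. f l * z ^ l) \<longlonglongrightarrow> F z"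
        unfolding F_def by (rule summable_LIMSEQ'[OF summable])
      then have "(\<lambda>J. \<Sum>l\<le>\<alpha> J. f l * z ^ l) \<longlonglongrightarrow> F z"
        using LIMSEQ_subseq_LIMSEQ[OF _ \<alpha>] by (force simp: o_def)
      then show ?thesis by (intro tendsto_intros)
    qed
    ultimately show ?thesis
      unfolding v_def r_def by (intro LIMSEQ_le_const2) auto
  qed
  \<comment> \<open>At the origin \<^const>\<open>omega\<close> has its separate value 0, so this one point is treated by itself.\<close>
  have "norm (F z) * weight M c (norm z) \<le> max D (norm (F 0) * weight M c 0)" for z
    using bound[of z] by (cases "z = 0") auto
  then have "F \<in> H_inf (weight M c)"
    unfolding H_inf_def using F_hol by (auto intro!: bdd_aboveI)
  with f_ge F_coeffs show ?thesis by metis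
qed

section \<open>The solid hull\<close>

lemma A_quot_eq: 
  "M \<in> LC \<Longrightarrow> k \<le> l \<Longrightarrow> A_quot M k l = M k * mu M (Suc l) ^ (l - k) / M l"
  by (simp only: A_quot_def prod_mu) simp

lemma B_quot_eq: 
  "M \<in> LC \<Longrightarrow> k \<le> l \<Longrightarrow> B_quot M k l = M l / (M k * mu M (Suc k) ^ (l - k))"
  by (simp only: B_quot_def prod_mu) simp

text \<open>
  On the critical circle \<open>f\<close> is at most \<open>S\<close> divided by the weight, and the Bessel inequality turns this
  uniform bound into one for square sums, which is inherited by smaller coefficients.
\<close>

lemma H_inf_coeff_block_bound:
  assumes "M \<in> LC" "c > 0" "f \<in> H_inf (weight M c)"
  shows "\<exists>S. \<forall>x n L. (\<forall>l. norm (x l) \<le> norm (taylor_coeffs f l)) \<longrightarrow> finite L \<longrightarrow>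
    weight M c (radius M c n) * sqrt (\<Sum>l\<in>L. (norm (x l :: complex))\<^sup>2 * radius M c n ^ (2 * l)) \<le> S"
proof -
  from assms(3) have hol: "f holomorphic_on UNIV" 
    and "bdd_above (range (\<lambda>z. norm (f z) * weight M c (norm z)))" by (auto simp: H_inf_def)
  then obtain S where S: "\<And>z. norm (f z) * weight M c (norm z) \<le> S" by (auto simp: bdd_above_def)
  show ?thesis
  proof (intro exI allI impI)
    fix x :: "nat \<Rightarrow> complex" and n and L :: "nat set" 
    assume x: "\<forall>l. norm (x l) \<le> norm (taylor_coeffs f l)" and L: "finite L"
    define r where "r = radius M c n"
    have r: "r > 0" unfolding r_def radius_def using assms mu_pos by simp
    note w = weight_pos[of M c r]
    have "0 \<le> norm (f (of_real r)) * weight M c r" using w by simp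
    with S[of "of_real r"] r have "S \<ge> 0" by simp
    have "(\<Sum>l\<in>L. (norm (x l))\<^sup>2 * r ^ (2 * l)) \<le> (\<Sum>l\<in>L. (norm (taylor_coeffs f l))\<^sup>2 * r ^ (2 * l))"
      using x r by (intro sum_mono mult_right_mono power_mono) auto
    also have "\<dots> \<le> (S / weight M c r)\<^sup>2"
    proof (rule taylor_coeffs_square_sum_le[OF hol r _ L])
      fix z :: complex assume "norm z = r"
      then show "norm (f z) \<le> S / weight M c r" using S[of z] w by (simp add: pos_le_divide_eq)
    qed
    finally have "sqrt (\<Sum>l\<in>L. (norm (x l))\<^sup>2 * r ^ (2 * l)) \<le> S / weight M c r"
      using \<open>S \<ge> 0\<close> w by (intro real_le_lsqrt) (auto intro!: sum_nonneg)
    then show "weight M c (radius M c n) * sqrt (\<Sum>l\<in>L. (norm (x l))\<^sup>2 * radius M c n ^ (2 * l)) \<le> S"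
      using w by (simp add: r_def pos_le_divide_eq mult.commute)
  qed
qed

theorem theorem4p3:
  fixes M :: "nat \<Rightarrow> real" and c b K :: real and a :: "nat \<Rightarrow> nat"
  assumes "M \<in> LC" and "c > 0"
    and "strict_mono_on {1..} a"
    and "b > 2" and "K \<ge> b"
    and "\<And>j. j \<ge> 1 \<Longrightarrow>
           b \<le> min (A_quot M (a j) (a (j + 1))) (B_quot M (a j) (a (j + 1)))"
    and "\<And>j. j \<ge> 1 \<Longrightarrow>
           max (A_quot M (a j) (a (j + 1))) (B_quot M (a j) (a (j + 1))) \<le> K"
  shows "solid_hull (H_inf_seq (weight M c)) =
           {x :: nat \<Rightarrow> complex. bdd_above ((\<lambda>j. weight M c (radius M c (a j)) *
              sqrt (\<Sum>l\<in>{a j<..a (j + 1)}. (norm (x l))\<^sup>2 * radius M c (a j) ^ (2 * l))) ` {1..})}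
    \<and> solid_hull (H_inf_seq (weight M c)) =
           {x :: nat \<Rightarrow> complex. bdd_above ((\<lambda>j. M (a j + 1) / mu M (a j + 1) ^ (a j + 1) *
              sqrt (\<Sum>l\<in>{a j<..a (j + 1)}. (norm (x l))\<^sup>2 * (mu M (a j + 1) / c) ^ (2 * l))) ` {1..})}"
    (is "?hull = ?X \<and> ?hull = ?Y")
proof -
  note LC = assms(1) and c = assms(2)
  note Mpos = LC_pos[OF LC] and mupos = mu_pos[OF LC]
  have "?hull = ?X"
  proof (intro antisym subsetI)
    fix x :: "nat \<Rightarrow> complex" assume "x \<in> ?hull"
    then obtain f where f: "f \<in> H_inf (weight M c)" "\<forall>l. norm (x l) \<le> norm (taylor_coeffs f l)"
      by (auto simp: solid_hull_def H_inf_seq_def)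
    with H_inf_coeff_block_bound[OF LC c f(1)] obtain S where 
      "\<And>n L. finite L \<Longrightarrow> weight M c (radius M c n) * sqrt (\<Sum>l\<in>L. (norm (x l))\<^sup>2 * radius M c n ^ (2 * l)) \<le> S"
      by blast
    then show "x \<in> ?X" by (auto intro!: bdd_aboveI)
  next
    fix x :: "nat \<Rightarrow> complex" assume "x \<in> ?X"
    then obtain B where B: "\<And>j. j \<ge> 1 \<Longrightarrow> weight M c (radius M c (a j)) *
        sqrt (\<Sum>l\<in>{a j<..a (j + 1)}. (norm (x l))\<^sup>2 * radius M c (a j) ^ (2 * l)) \<le> B"
      by (auto simp: bdd_above_def)
    \<comment> \<open>The blocks are numbered from 1 in \<open>a\<close> and from 0 in \<open>\<alpha>\<close>; \<open>a 0\<close> bounds no block.\<close>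
    define \<alpha> where "\<alpha> j = a (Suc j)" for j
    have \<alpha>: "strict_mono \<alpha>"
      using assms(3) by (auto simp: strict_mono_def strict_mono_on_def \<alpha>_def)
    have le: "\<alpha> j \<le> \<alpha> (Suc j)" for j using \<alpha> by (simp add: strict_mono_less_eq)
    have quot: "2 \<le> A_quot M (\<alpha> j) (\<alpha> (Suc j))" "2 \<le> B_quot M (\<alpha> j) (\<alpha> (Suc j))" 
      "B_quot M (\<alpha> j) (\<alpha> (Suc j)) \<le> K" for j
      using assms(4) assms(6,7)[of "Suc j"] by (auto simp: \<alpha>_def)
    have "\<exists>f\<in>H_inf (weight M c). \<forall>l. norm (x l) \<le> norm (taylor_coeffs f l)"
    proof (rule block_majorant_exists[OF LC c \<alpha>, where K = K and B = B])
      fix j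
      note pos = Mpos[of "\<alpha> j"] Mpos[of "\<alpha> (Suc j)"] mupos[of "Suc (\<alpha> j)"]
      show "2 * M (\<alpha> (Suc j)) \<le> M (\<alpha> j) * mu M (Suc (\<alpha> (Suc j))) ^ (\<alpha> (Suc j) - \<alpha> j)"
        using quot(1)[of j] pos unfolding A_quot_eq[OF LC le] by (simp add: pos_le_divide_eq)
      show "2 * (M (\<alpha> j) * mu M (Suc (\<alpha> j)) ^ (\<alpha> (Suc j) - \<alpha> j)) \<le> M (\<alpha> (Suc j))"
        using quot(2)[of j] pos unfolding B_quot_eq[OF LC le] by (simp add: pos_le_divide_eq)
      show "M (\<alpha> (Suc j)) \<le> K * (M (\<alpha> j) * mu M (Suc (\<alpha> j)) ^ (\<alpha> (Suc j) - \<alpha> j))"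
        using quot(3)[of j] pos unfolding B_quot_eq[OF LC le] by (simp add: pos_divide_le_eq)
      show "M (\<alpha> j) / mu M (Suc (\<alpha> j)) ^ \<alpha> j * sqrt (\<Sum>l\<in>{\<alpha> j<..\<alpha> (Suc j)}. 
          (norm (x l))\<^sup>2 * (mu M (Suc (\<alpha> j)) / c) ^ (2 * l)) \<le> B"
        using B[of "Suc j"] unfolding weight_radius[OF LC c] by (simp add: \<alpha>_def radius_def)
    qed
    then show "x \<in> ?hull" by (auto simp: solid_hull_def H_inf_seq_def)
  qed
  moreover have "?X = ?Y" 
    by (simp only: radius_def weight_radius'[OF LC c, unfolded radius_def])
  ultimately show ?thesis by simp
qed

end
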